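(* Let $p\in\Gamma_{n,d}$ be a hook-shaped symmetric polynomial, with associated operator $T$. Then $T$ is a diagonal linear map. Moreover, $p$ is symmetric hyperbolic if and only if $T$ is a 0-sum hyperbolicity preserver. The map sending a hook-shaped polynomial in $\Gamma_{n,d}$ to its associated operator (a diagonal linear map $\mathbb{R}[t]_{n,0}\to\mathbb{R}[t]_{d,0}$) is linear and invertible.
   Context: $\vec 1=(1,\dots,1)\in\mathbb{R}^n$ and $e_i$ is the $i$-th elementary symmetric polynomial in $x_1,\dots,x_n$. A homogeneous $p\in\mathbb{R}[x_1,\dots,x_n]$ is hyperbolic with respect to $v\in\mathbb{R}^n$ if $p(v)\ne 0$ and for every $x\in\mathbb{R}^n$ the univariate polynomial $p(x+tv)$ in $t$ has only real roots. $p$ is symmetric hyperbolic if it is invariant under all permutations of the variables and hyperbolic with respect to $\vec 1$. $\Gamma_{n,d}$ is the vector space of hook-shaped symmetric polynomials of degree $d$ in $n$ variables, i.e. polynomials $p=\sum_{i=1}^d a_i e_1^{d-i}e_i$ with $a_i\in\mathbb{R}$. $\mathbb{R}[t]_{n,0}$ is the vector space of real univariate polynomials of degree at most $n$ whose coefficient of $t^{n-1}$ is $0$. $\mathcal{H}_{n,0}$ is the set of polynomials in $\mathbb{R}[t]_{n,0}$ with only real roots. A linear map $T:\mathbb{R}[t]_{n,0}\to\mathbb{R}[t]_{d,0}$ is a 0-sum hyperbolicity preserver if $T(\mathcal{H}_{n,0})\subseteq\mathcal{H}_{d,0}$. It is diagonal if there are reals $\gamma_k$ such that $T(t^{n-k})=\gamma_k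 t^{d-k}$ for all $0\le k\le d$, $k\neq 1$, and $T(t^{n-k})=0$ for $k>d$. The associated operator of $p\in\Gamma_{n,d}$ is the map $T:\mathbb{R}[t]_{n,0}\to\mathbb{R}[t]_{d,0}$ defined as follows: if $g(t)=a(t-r_1)\cdots(t-r_n)\in\mathbb{R}[t]_{n,0}$ with $a\in\mathbb{R}\setminus\{0\}$ and $r_1,\dots,r_n\in\mathbb{C}$, then $T(g)(t)=a\,p(\vec r-t\vec 1)$ with $\vec r=(r_1,\dots,r_n)$; this is extended to all $g\in\mathbb{R}[t]_{n,0}$ (including those of degree less than $n$) by continuity.
   Formalization: The equivalence proved is: p is symmetric hyperbolic iff p(1,…,1) ≠ 0 and T is a 0-sum hyperbolicity preserver (0 counts as real-rooted, d ≥ 1). Without p(1,…,1) ≠ 0 it fails: n=d=2, p=(x_1−x_2)^2 has T(at^2+c) = −4c, a preserver, but p is not hyperbolic. *)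

theory Defs
  imports "HOL-Analysis.Analysis" "HOL-Library.Poly_Mapping" "HOL-Computational_Algebra.Polynomial"
begin

text \<open>
  Real polynomials in variables indexed by the finite type \<open>'n\<close>, so that \<open>n = CARD('n)\<close>:
  a polynomial maps exponent vectors to coefficients.
\<close>

type_synonym 'n mpol = "('n \<Rightarrow>\<^sub>0 nat) \<Rightarrow>\<^sub>0 real"

definition Const :: "real \<Rightarrow> 'n::finite mpol" where
  "Const c = Poly_Mapping.single 0 c"

definition Var :: "'n::finite \<Rightarrow> 'n mpol" where
  "Var i = Poly_Mapping.single (Poly_Mapping.single i 1) 1"

text \<open>
  Evaluation in a commutative ring; \<open>h\<close> embeds the real coefficients. It is used below with
  values in the reals, the complex numbers and the univariate real polynomials.
\<close>

definition mp_eval :: "(real \<Rightarrow> 'a::comm_semiring_1) \<Rightarrow> ('n::finite \<Rightarrow> 'a) \<Rightarrow> 'n mpol \<Rightarrow> 'a" where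
  "mp_eval h x p =
     (\<Sum>m\<in>Poly_Mapping.keys p. h (Poly_Mapping.lookup p m) * (\<Prod>i\<in>UNIV. x i ^ Poly_Mapping.lookup m i))"

abbreviation eval_real :: "'n::finite mpol \<Rightarrow> real ^ 'n \<Rightarrow> real" where
  "eval_real p x \<equiv> mp_eval (\<lambda>c. c) (\<lambda>i. x $ i) p"

abbreviation eval_complex :: "'n::finite mpol \<Rightarrow> complex ^ 'n \<Rightarrow> complex" where
  "eval_complex p z \<equiv> mp_eval complex_of_real (\<lambda>i. z $ i) p"

definition homogeneous :: "nat \<Rightarrow> 'n::finite mpol \<Rightarrow> bool" where
  "homogeneous k p \<longleftrightarrow> (\<forall>m\<in>Poly_Mapping.keys p. (\<Sum>i\<in>UNIV. Poly_Mapping.lookup m i) = k)"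

definition symmetric :: "'n::finite mpol \<Rightarrow> bool" where
  "symmetric p \<longleftrightarrow> (\<forall>\<pi>::'n \<Rightarrow> 'n. bij \<pi> \<longrightarrow>
     (\<forall>m. Poly_Mapping.lookup p (Poly_Mapping.map_key \<pi> m) = Poly_Mapping.lookup p m))"

text \<open>The zero polynomial counts as real-rooted, as do the nonzero constants.\<close>

definition real_rooted :: "real poly \<Rightarrow> bool" where
  "real_rooted q \<longleftrightarrow> q = 0 \<or> (\<forall>z. poly (map_poly complex_of_real q) z = 0 \<longrightarrow> z \<in> \<real>)"

definition line_restriction :: "'n::finite mpol \<Rightarrow> real ^ 'n \<Rightarrow> real ^ 'n \<Rightarrow> real poly" where
  "line_restriction p x v = mp_eval (\<lambda>c. [:c:]) (\<lambda>i. [:x $ i, v $ i:]) p"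

definition hyperbolic :: "'n::finite mpol \<Rightarrow> real ^ 'n \<Rightarrow> bool" where
  "hyperbolic p v \<longleftrightarrow>
     (\<exists>k. homogeneous k p) \<and> eval_real p v \<noteq> 0 \<and> (\<forall>x. real_rooted (line_restriction p x v))"

definition symmetric_hyperbolic :: "'n::finite mpol \<Rightarrow> bool" where
  "symmetric_hyperbolic p \<longleftrightarrow> symmetric p \<and> hyperbolic p 1"

definition elem_sym :: "nat \<Rightarrow> 'n::finite mpol" where
  "elem_sym k = (\<Sum>S | card S = k. \<Prod>i\<in>S. Var i)"

definition hook_shaped :: "nat \<Rightarrow> 'n::finite mpol set" where
  "hook_shaped d =
     {p. \<exists>a :: nat \<Rightarrow> real. p = (\<Sum>i=1..d. Const (a i) * elem_sym 1 ^ (d - i) * elem_sym i)}"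

text \<open>The space \<open>\<real>[t]\<close> with indices \<open>n,0\<close>; for \<open>n = 0\<close> there is no coefficient of \<open>t\<^sup>n\<^sup>-\<^sup>1\<close>.\<close>

definition zero_sum_polys :: "nat \<Rightarrow> real poly set" where
  "zero_sum_polys n = {g. degree g \<le> n \<and> (n \<ge> 1 \<longrightarrow> coeff g (n - 1) = 0)}"

definition zero_sum_real_rooted :: "nat \<Rightarrow> real poly set" where
  "zero_sum_real_rooted n = {g \<in> zero_sum_polys n. real_rooted g}"

text \<open>
  Maps between the spaces are extensional functions, so that two of them are equal as soon as
  they agree on the domain.
\<close>

definition linear_maps :: "nat \<Rightarrow> nat \<Rightarrow> (real poly \<Rightarrow> real poly) set" where
  "linear_maps n d = {T \<in> zero_sum_polys n \<rightarrow>\<^sub>E zero_sum_polys d.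
     (\<forall>f\<in>zero_sum_polys n. \<forall>g\<in>zero_sum_polys n. T (f + g) = T f + T g) \<and>
     (\<forall>c. \<forall>g\<in>zero_sum_polys n. T (smult c g) = smult c (T g))}"

text \<open>The bound \<open>k \<le> n\<close> matters only for truncated subtraction: \<open>t\<^sup>n\<^sup>-\<^sup>k\<close> has to be a monomial.\<close>

definition diagonal :: "nat \<Rightarrow> nat \<Rightarrow> (real poly \<Rightarrow> real poly) \<Rightarrow> bool" where
  "diagonal n d T \<longleftrightarrow> (\<exists>\<gamma> :: nat \<Rightarrow> real.
     (\<forall>k\<le>n. k \<le> d \<and> k \<noteq> 1 \<longrightarrow> T (monom 1 (n - k)) = smult (\<gamma> k) (monom 1 (d - k))) \<and>
     (\<forall>k\<le>n. k > d \<longrightarrow> T (monom 1 (n - k)) = 0))"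

definition diagonal_maps :: "nat \<Rightarrow> nat \<Rightarrow> (real poly \<Rightarrow> real poly) set" where
  "diagonal_maps n d = {T \<in> linear_maps n d. diagonal n d T}"

text \<open>
  Constants and 0 are real-rooted, so a preserver may annihilate \<open>t\<^sup>n\<close>; the associated operator of
  \<open>p\<close> does so exactly when \<open>p(1) = 0\<close>, which hyperbolicity excludes. For instance
  \<open>(x\<^sub>1 - x\<^sub>2)\<^sup>2 = e\<^sub>1\<^sup>2 - 4 e\<^sub>2\<close> with \<open>n = d = 2\<close> has associated operator \<open>a t\<^sup>2 + c \<mapsto> - 4 c\<close>, a preserver,
  but is not hyperbolic. Hence the equivalence between hyperbolicity and preservation needs
  \<open>p(1) \<noteq> 0\<close> as an explicit clause.
\<close>

definition zero_sum_preserver :: "nat \<Rightarrow> nat \<Rightarrow> (real poly \<Rightarrow> real poly) \<Rightarrow> bool" where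
  "zero_sum_preserver n d T \<longleftrightarrow>
     T \<in> linear_maps n d \<and> T ` zero_sum_real_rooted n \<subseteq> zero_sum_real_rooted d"

text \<open>
  Continuity for the Euclidean topology on the coefficients; sequences suffice because the
  spaces are finite-dimensional.
\<close>

definition coeff_tendsto :: "(nat \<Rightarrow> real poly) \<Rightarrow> real poly \<Rightarrow> bool" where
  "coeff_tendsto G g \<longleftrightarrow> (\<forall>i. (\<lambda>k. coeff (G k) i) \<longlonglongrightarrow> coeff g i)"

definition coeff_continuous :: "nat \<Rightarrow> (real poly \<Rightarrow> real poly) \<Rightarrow> bool" where
  "coeff_continuous n T \<longleftrightarrow>
     (\<forall>G g. (\<forall>k. G k \<in> zero_sum_polys n) \<and> g \<in> zero_sum_polys n \<and> coeff_tendsto G g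
        \<longrightarrow> coeff_tendsto (\<lambda>k. T (G k)) (T g))"

text \<open>
  The root formula prescribes the operator on the polynomials of degree exactly \<open>n\<close>, which are
  dense in the domain; continuity then determines it everywhere.
\<close>

definition is_associated_operator ::
    "nat \<Rightarrow> 'n::finite mpol \<Rightarrow> (real poly \<Rightarrow> real poly) \<Rightarrow> bool" where
  "is_associated_operator d p T \<longleftrightarrow>
     T \<in> zero_sum_polys CARD('n) \<rightarrow>\<^sub>E zero_sum_polys d \<and>
     (\<forall>g\<in>zero_sum_polys CARD('n). \<forall>a (r :: complex ^ 'n).
        a \<noteq> 0 \<and> map_poly complex_of_real g = smult (complex_of_real a) (\<Prod>i\<in>UNIV. [:- (r $ i), 1:]) \<longrightarrow>
        (\<forall>t. poly (map_poly complex_of_real (T g)) t = complex_of_real a * eval_complex p (r - t *s 1))) \<and>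
     coeff_continuous CARD('n) T"

definition associated_operator :: "nat \<Rightarrow> 'n::finite mpol \<Rightarrow> real poly \<Rightarrow> real poly" where
  "associated_operator d p = (THE T. is_associated_operator d p T)"

end

theory Submission
  imports Defs "HOL-Complex_Analysis.Great_Picard" "HOL-Computational_Algebra.Fundamental_Theorem_Algebra"
begin

text \<open>
  Let \<open>p\<close> be the sum of the \<open>a\<^sub>i e\<^sub>1\<^sup>d\<^sup>-\<^sup>i e\<^sub>i\<close>. When the roots \<open>r\<close> of \<open>g\<close> sum to zero, \<open>e\<^sub>1(r - t)\<close> equals
  \<open>- n t\<close>, and expanding \<open>e\<^sub>i(r - t)\<close> in the \<open>e\<^sub>j(r)\<close>, which are up to sign the coefficients of \<open>g\<close>,
  shows that the operator \<open>T\<close> is diagonal. Its entries \<open>\<gamma>\<^sub>j\<close> depend on the \<open>a\<^sub>i\<close> through a triangular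
  system with nonzero diagonal, once \<open>\<gamma>\<^sub>0\<close> is paired with \<open>a\<^sub>1\<close>; hence the bijection.

  Translating \<open>x\<close> along the all-ones vector to sum zero turns \<open>p(x + t)\<close> into \<open>T(g)\<close> for the monic
  \<open>g\<close> with roots \<open>x\<close>, up to an affine substitution, which gives the equivalence for \<open>g\<close> of degree
  \<open>n\<close>. A real-rooted \<open>g\<close> of smaller degree is a limit of such polynomials, and Hurwitz' theorem
  applies because \<open>p(1) \<noteq> 0\<close> keeps the images of the approximants from vanishing.
\<close>

unbundle no fps_syntax

section \<open>Evaluation of multivariate polynomials\<close>

text \<open>Inserting a new key amounts to adding a monomial. Identities that are additive in the
  polynomial thus reduce to monomials.\<close>

lemma poly_mapping_single_induct [case_names zero add]:
  assumes "P 0" and "\<And>m c p. P p \<Longrightarrow> P (Poly_Mapping.single m c + p)"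
  shows "P p"
proof (induction p rule: Poly_Mapping.update_induct)
  case const
  then show ?case using assms(1) .
next
  case (update p m c)
  have "Poly_Mapping.update m c p = Poly_Mapping.single m c + p"
    using update.hyps(1)
    by (intro poly_mapping_eqI)
       (auto simp: lookup_update lookup_add lookup_single when_def in_keys_iff)
  then show ?case
    using assms(2) update.IH by simp
qed

text \<open>The laws of evaluation are proved once for a semiring homomorphism \<open>h\<close> and
  then interpreted for real and complex values.\<close>

locale coeff_hom =
  fixes h :: "real \<Rightarrow> 'a::comm_semiring_1"
  assumes hom_0: "h 0 = 0" and hom_1: "h 1 = 1"
    and hom_add: "h (a + b) = h a + h b" and hom_mult: "h (a * b) = h a * h b"
begin

lemma mp_eval_single:
  "mp_eval h x (Poly_Mapping.single m c) = h c * (\<Prod>i\<in>UNIV. x i ^ Poly_Mapping.lookup m i)"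
  by (cases "c = 0") (auto simp: mp_eval_def hom_0)

lemma mp_eval_0: "mp_eval h x 0 = 0"
  by (simp add: mp_eval_def)

lemma mp_eval_add: "mp_eval h x (p + q) = mp_eval h x p + mp_eval h x q"
  unfolding mp_eval_def
  by (rule setsum_keys_plus_distrib) (auto simp: hom_0 hom_add distrib_right)

text \<open>Both sides are additive in each factor, so two nested inductions reduce the claim to two
  monomials, whose exponents add.\<close>

lemma mp_eval_mult: "mp_eval h x (p * q) = mp_eval h x p * mp_eval h x q"
proof (induction p rule: poly_mapping_single_induct)
  case zero
  then show ?case by (simp add: mp_eval_0)
next
  case (add m c p)
  have "mp_eval h x (Poly_Mapping.single m c * q) = mp_eval h x (Poly_Mapping.single m c) * mp_eval h x q"
  proof (induction q rule: poly_mapping_single_induct)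
    case zero
    then show ?case by (simp add: mp_eval_0)
  next
    case (add m' c' q)
    have "mp_eval h x (Poly_Mapping.single m c * Poly_Mapping.single m' c') =
        mp_eval h x (Poly_Mapping.single m c) * mp_eval h x (Poly_Mapping.single m' c')"
      by (simp add: mult_single mp_eval_single hom_mult lookup_add power_add prod.distrib ac_simps)
    then show ?case
      using add by (simp add: algebra_simps mp_eval_add)
  qed
  then show ?case
    using add by (simp add: algebra_simps mp_eval_add)
qed

lemma mp_eval_Const: "mp_eval h x (Const c) = h c"
  by (simp add: Const_def mp_eval_single)

lemma mp_eval_1: "mp_eval h x 1 = 1"
  using mp_eval_Const[of x 1] by (simp add: Const_def hom_1)

lemma mp_eval_Var: "mp_eval h x (Var i) = x i"
proof -
  have "(\<Prod>j\<in>UNIV. x j ^ Poly_Mapping.lookup (Poly_Mapping.single i (1::nat)) j) = (\<Prod>j\<in>UNIV. if i = j then x j else 1)"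
    by (intro prod.cong) (auto simp: lookup_single)
  then show ?thesis
    by (simp add: Var_def mp_eval_single hom_1)
qed

lemma mp_eval_sum: "mp_eval h x (\<Sum>i\<in>A. f i) = (\<Sum>i\<in>A. mp_eval h x (f i))"
  by (induction A rule: infinite_finite_induct) (auto simp: mp_eval_0 mp_eval_add)

lemma mp_eval_prod: "mp_eval h x (\<Prod>i\<in>A. f i) = (\<Prod>i\<in>A. mp_eval h x (f i))"
  by (induction A rule: infinite_finite_induct) (auto simp: mp_eval_1 mp_eval_mult)

lemma mp_eval_power: "mp_eval h x (p ^ k) = mp_eval h x p ^ k"
  by (induction k) (auto simp: mp_eval_1 mp_eval_mult)

end

interpretation real_hom: coeff_hom "\<lambda>c::real. c"
  by unfold_locales auto

interpretation complex_hom: coeff_hom complex_of_real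
  by unfold_locales auto

lemma map_poly_of_real_add:
  "map_poly complex_of_real (p + q) = map_poly complex_of_real p + map_poly complex_of_real q"
  by (rule poly_eqI) (simp add: coeff_map_poly)

lemma map_poly_of_real_mult:
  "map_poly complex_of_real (p * q) = map_poly complex_of_real p * map_poly complex_of_real q"
  by (rule poly_eqI) (simp add: coeff_map_poly coeff_mult)

lemma map_poly_of_real_sum:
  "map_poly complex_of_real (\<Sum>i\<in>A. f i) = (\<Sum>i\<in>A. map_poly complex_of_real (f i))"
  by (induction A rule: infinite_finite_induct) (auto simp: map_poly_of_real_add)

lemma map_poly_of_real_prod:
  "map_poly complex_of_real (\<Prod>i\<in>A. f i) = (\<Prod>i\<in>A. map_poly complex_of_real (f i))"
  by (induction A rule: infinite_finite_induct) (auto simp: map_poly_of_real_mult)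

lemma map_poly_of_real_power:
  "map_poly complex_of_real (p ^ k) = map_poly complex_of_real p ^ k"
  by (induction k) (auto simp: map_poly_of_real_mult)

lemma map_poly_of_real_eq_iff:
  "map_poly complex_of_real p = map_poly complex_of_real q \<longleftrightarrow> p = q"
  by (auto simp: poly_eq_iff coeff_map_poly)

text \<open>Composing with evaluation at \<open>t\<close> turns polynomial values into complex ones;
  line restrictions are handled in this way.\<close>

lemma poly_mp_eval:
  "poly (map_poly complex_of_real (mp_eval (\<lambda>c. [:c:]) f p)) t =
     mp_eval complex_of_real (\<lambda>i. poly (map_poly complex_of_real (f i)) t) p"
  by (simp add: mp_eval_def map_poly_of_real_sum map_poly_of_real_mult map_poly_of_real_prod
      map_poly_of_real_power map_poly_smult poly_sum poly_prod poly_power)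

section \<open>Homogeneity\<close>

lemma homogeneous_add: "homogeneous k p \<Longrightarrow> homogeneous k q \<Longrightarrow> homogeneous k (p + q)"
  using Poly_Mapping.keys_add[of p q] unfolding homogeneous_def by blast

lemma homogeneous_0: "homogeneous k 0"
  by (simp add: homogeneous_def)

lemma homogeneous_mult: "homogeneous k p \<Longrightarrow> homogeneous l q \<Longrightarrow> homogeneous (k + l) (p * q)"
  using keys_mult[of p q] unfolding homogeneous_def
  by (fastforce simp: lookup_add sum.distrib)

lemma homogeneous_Const: "homogeneous 0 (Const c)"
  by (cases "c = 0") (auto simp: homogeneous_def Const_def)

lemma homogeneous_1: "homogeneous 0 1"
  using homogeneous_Const[of 1] by (simp add: Const_def)

lemma homogeneous_Var: "homogeneous 1 (Var i)"
proof -
  have "(\<Sum>j\<in>UNIV. Poly_Mapping.lookup (Poly_Mapping.single i (1::nat)) j) = (\<Sum>j\<in>UNIV. if i = j then 1 else 0)"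
    by (intro sum.cong) (auto simp: lookup_single)
  then show ?thesis
    by (simp add: homogeneous_def Var_def)
qed

lemma homogeneous_sum: "(\<And>i. i \<in> A \<Longrightarrow> homogeneous k (f i)) \<Longrightarrow> homogeneous k (\<Sum>i\<in>A. f i)"
  by (induction A rule: infinite_finite_induct) (auto simp: homogeneous_0 homogeneous_add)

lemma homogeneous_prod:
  "(\<And>i. i \<in> A \<Longrightarrow> homogeneous (k i) (f i)) \<Longrightarrow> homogeneous (\<Sum>i\<in>A. k i) (\<Prod>i\<in>A. f i)"
  by (induction A rule: infinite_finite_induct) (auto simp: homogeneous_1 homogeneous_mult)

lemma homogeneous_power: "homogeneous k p \<Longrightarrow> homogeneous (k * l) (p ^ l)"
  by (induction l) (auto simp: homogeneous_1 homogeneous_mult)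

lemma homogeneous_elem_sym: "homogeneous k (elem_sym k :: 'n::finite mpol)"
proof -
  have "homogeneous k (\<Prod>i\<in>S. Var i :: 'n mpol)" if "card S = k" for S :: "'n set"
    using homogeneous_prod[of S "\<lambda>_. 1" Var, OF homogeneous_Var] that by simp
  then show ?thesis
    unfolding elem_sym_def by (intro homogeneous_sum) auto
qed

section \<open>Invariance under permutations of the variables\<close>

context
  fixes \<pi> :: "'n::finite \<Rightarrow> 'n"
  assumes bij: "bij \<pi>"
begin

text \<open>\<open>map_key\<close> acts as composition only along injective maps, and relabelling a
  polynomial applies it along \<open>map_key \<pi>\<close> itself.\<close>

lemma inj_map_key: "inj (Poly_Mapping.map_key \<pi> :: ('n \<Rightarrow>\<^sub>0 nat) \<Rightarrow> _)"
proof (rule injI, rule poly_mapping_eqI)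
  fix m m' :: "'n \<Rightarrow>\<^sub>0 nat" and i
  assume *: "Poly_Mapping.map_key \<pi> m = Poly_Mapping.map_key \<pi> m'"
  obtain j where "i = \<pi> j"
    using bij bij_is_surj by blast
  with arg_cong[OF *, of "\<lambda>m. Poly_Mapping.lookup m j"]
  show "Poly_Mapping.lookup m i = Poly_Mapping.lookup m' i"
    by (simp add: map_key.rep_eq bij_is_inj[OF bij])
qed

lemma map_key_inv: "Poly_Mapping.map_key \<pi> (Poly_Mapping.map_key (inv \<pi>) m) = m"
  using bij by (simp add: map_key_compose bij_is_inj bij_imp_bij_inv map_key_id o_def)

text \<open>The ring endomorphism that renames \<open>Var i\<close> to \<open>Var (\<pi> i)\<close>.
  Being \<open>symmetric\<close> means being fixed by all of these.\<close>

abbreviation relabel :: "'n mpol \<Rightarrow> 'n mpol" where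
  "relabel \<equiv> Poly_Mapping.map_key (Poly_Mapping.map_key \<pi>)"

lemma relabel_single:
  "relabel (Poly_Mapping.single m c) = Poly_Mapping.single (Poly_Mapping.map_key (inv \<pi>) m) c"
  using map_key_single[OF inj_map_key, of "Poly_Mapping.map_key (inv \<pi>) m" c]
  by (simp add: map_key_inv)

lemma relabel_add: "relabel (p + q) = relabel p + relabel q"
  by (rule map_key_plus[OF inj_map_key])

lemma relabel_0: "relabel 0 = 0"
  by (rule map_key_zero[OF inj_map_key])

lemma relabel_mult: "relabel (p * q) = relabel p * relabel q"
proof (induction p rule: poly_mapping_single_induct)
  case zero
  then show ?case by (simp add: relabel_0)
next
  case (add m c p)
  have "relabel (Poly_Mapping.single m c * q) = relabel (Poly_Mapping.single m c) * relabel q"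
  proof (induction q rule: poly_mapping_single_induct)
    case zero
    then show ?case by (simp add: relabel_0)
  next
    case (add m' c' q)
    have "relabel (Poly_Mapping.single m c * Poly_Mapping.single m' c') =
        relabel (Poly_Mapping.single m c) * relabel (Poly_Mapping.single m' c')"
      using bij by (simp add: mult_single relabel_single map_key_plus bij_is_inj bij_imp_bij_inv)
    then show ?case
      using add by (simp add: algebra_simps relabel_add)
  qed
  then show ?case
    using add by (simp add: algebra_simps relabel_add)
qed

lemma relabel_Const: "relabel (Const c) = Const c"
  using bij by (simp add: Const_def relabel_single map_key_zero bij_is_inj bij_imp_bij_inv)

lemma relabel_1: "relabel 1 = 1"
  using relabel_Const[of 1] by (simp add: Const_def)

lemma relabel_Var: "relabel (Var i) = Var (\<pi> i)"
  using map_key_single[of "inv \<pi>" "\<pi> i" "1::nat"] bij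
  by (simp add: Var_def relabel_single bij_is_inj bij_imp_bij_inv)

lemma relabel_sum: "relabel (\<Sum>i\<in>A. f i) = (\<Sum>i\<in>A. relabel (f i))"
  by (induction A rule: infinite_finite_induct) (auto simp: relabel_0 relabel_add)

lemma relabel_prod: "relabel (\<Prod>i\<in>A. f i) = (\<Prod>i\<in>A. relabel (f i))"
  by (induction A rule: infinite_finite_induct) (auto simp: relabel_1 relabel_mult)

lemma relabel_power: "relabel (p ^ k) = relabel p ^ k"
  by (induction k) (auto simp: relabel_1 relabel_mult)

text \<open>The bijection \<open>\<pi>\<close> permutes the sets of size \<open>k\<close>, so
  renaming only reorders the sum over them.\<close>

lemma relabel_elem_sym: "relabel (elem_sym k) = elem_sym k"
proof -
  have "relabel (elem_sym k) = (\<Sum>S | card S = k. \<Prod>i\<in>S. Var (\<pi> i))"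
    by (simp add: elem_sym_def relabel_sum relabel_prod relabel_Var)
  also have "\<dots> = (\<Sum>S | card S = k. \<Prod>i\<in>\<pi> ` S. Var i)"
    by (intro sum.cong refl, subst prod.reindex)
       (auto intro: inj_on_subset[OF bij_is_inj[OF bij]])
  also have "\<dots> = (\<Sum>S | card S = k. \<Prod>i\<in>S. Var i)"
  proof (rule sum.reindex_bij_betw)
    have card: "card (f ` S) = card S" if "bij f" for f :: "'n \<Rightarrow> 'n" and S
      using that by (metis bij_is_inj card_image inj_on_subset subset_UNIV)
    show "bij_betw ((`) \<pi>) {S. card S = k} {S. card S = k}"
      using bij card[OF bij] card[OF bij_imp_bij_inv[OF bij]]
      by (intro bij_betw_byWitness[where f' = "(`) (inv \<pi>)"])
         (auto simp: image_image bij_is_inj bij_is_surj surj_f_inv_f)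
  qed
  finally show ?thesis
    by (simp add: elem_sym_def)
qed

end

lemma symmetricI:
  assumes "\<And>\<pi>::'n \<Rightarrow> 'n. bij \<pi> \<Longrightarrow> Poly_Mapping.map_key (Poly_Mapping.map_key \<pi>) p = p"
  shows "symmetric (p :: 'n::finite mpol)"
  unfolding symmetric_def
proof (intro allI impI)
  fix \<pi> :: "'n \<Rightarrow> 'n" and m
  assume "bij \<pi>"
  then have "Poly_Mapping.lookup (Poly_Mapping.map_key (Poly_Mapping.map_key \<pi>) p) m =
      Poly_Mapping.lookup p (Poly_Mapping.map_key \<pi> m)"
    by (simp add: map_key.rep_eq inj_map_key)
  with assms[OF \<open>bij \<pi>\<close>]
  show "Poly_Mapping.lookup p (Poly_Mapping.map_key \<pi> m) = Poly_Mapping.lookup p m"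
    by simp
qed

section \<open>Hook-shaped polynomials\<close>

text \<open>Makes the coefficients accessible. Different \<open>a\<close> may give the same
  polynomial, since \<open>elem_sym i\<close> vanishes once \<open>i\<close> exceeds the number of
  variables.\<close>

definition hook :: "nat \<Rightarrow> (nat \<Rightarrow> real) \<Rightarrow> 'n::finite mpol" where
  "hook d a = (\<Sum>i=1..d. Const (a i) * elem_sym 1 ^ (d - i) * elem_sym i)"

lemma hook_shaped_eq: "hook_shaped d = range (hook d)"
  by (auto simp: hook_shaped_def hook_def)

lemma homogeneous_hook: "homogeneous d (hook d a)"
  unfolding hook_def
proof (rule homogeneous_sum)
  fix i assume "i \<in> {1..d}"
  then have "0 + 1 * (d - i) + i = d"
    by simp
  then show "homogeneous d (Const (a i) * elem_sym 1 ^ (d - i) * elem_sym i)"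
    by (metis homogeneous_mult homogeneous_power homogeneous_elem_sym homogeneous_Const)
qed

lemma symmetric_hook: "symmetric (hook d a)"
  by (rule symmetricI)
     (simp add: hook_def relabel_sum relabel_mult relabel_power relabel_elem_sym relabel_Const)

lemma hook_add: "hook d (\<lambda>i. a i + b i) = hook d a + hook d b"
  by (simp add: hook_def Const_def single_add algebra_simps sum.distrib)

lemma hook_mult: "hook d (\<lambda>i. c * a i) = (Const c * hook d a :: 'n::finite mpol)"
proof -
  have "(Const (c * x) :: 'n mpol) = Const c * Const x" for x
    by (simp add: Const_def mult_single)
  then show ?thesis
    by (simp add: hook_def sum_distrib_left mult.assoc)
qed

lemma elem_sym_eq_0: "k > CARD('n) \<Longrightarrow> (elem_sym k :: 'n::finite mpol) = 0"
proof -
  assume "k > CARD('n)"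
  then have "{S :: 'n set. card S = k} = {}"
    using card_mono[of UNIV "_ :: 'n set"] by (auto simp: not_le[symmetric])
  then show ?thesis
    by (simp add: elem_sym_def)
qed

section \<open>Elementary symmetric functions: translation and Vieta's formula\<close>

definition esym :: "nat \<Rightarrow> ('n::finite \<Rightarrow> 'a::comm_semiring_1) \<Rightarrow> 'a" where
  "esym k x = (\<Sum>S | card S = k. \<Prod>i\<in>S. x i)"

lemma (in coeff_hom) mp_eval_elem_sym: "mp_eval h x (elem_sym k) = esym k x"
  by (simp add: elem_sym_def esym_def mp_eval_sum mp_eval_prod mp_eval_Var)

lemma (in coeff_hom) mp_eval_hook:
  "mp_eval h x (hook d a) = (\<Sum>i=1..d. h (a i) * esym 1 x ^ (d - i) * esym i x)"
  by (simp add: hook_def mp_eval_sum mp_eval_mult mp_eval_power mp_eval_Const mp_eval_elem_sym)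

lemma esym_1:
  fixes x :: "'n::finite \<Rightarrow> 'a::comm_semiring_1"
  shows "esym 1 x = (\<Sum>i\<in>UNIV. x i)"
proof -
  have singletons: "{S :: 'n set. card S = 1} = (\<lambda>i. {i}) ` UNIV"
    by (auto simp: card_1_singleton_iff)
  show ?thesis
    unfolding esym_def singletons by (simp add: sum.reindex)
qed

lemma esym_eq_0: "k > CARD('n) \<Longrightarrow> esym k (x :: 'n::finite \<Rightarrow> 'a::comm_semiring_1) = 0"
proof -
  assume "k > CARD('n)"
  then have "card S \<noteq> k" for S :: "'n set"
    using card_mono[of UNIV S] by auto
  then show ?thesis
    by (simp add: esym_def)
qed

lemma card_Compl: "card (- U) = CARD('n) - card U" for U :: "'n::finite set"
  unfolding Compl_eq_Diff_UNIV by (rule card_Diff_subset) auto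

text \<open>Removing \<open>U\<close> identifies these sets with the subsets of the complement of
  \<open>U\<close> that have size \<open>k - card U\<close>.\<close>

lemma card_supersets:
  fixes U :: "'n::finite set"
  assumes "card U \<le> k"
  shows "card {S. card S = k \<and> U \<subseteq> S} = (CARD('n) - card U) choose (k - card U)"
proof -
  have "bij_betw (\<lambda>S. S - U) {S. card S = k \<and> U \<subseteq> S} {B. B \<subseteq> - U \<and> card B = k - card U}"
  proof (rule bij_betw_byWitness[where f' = "\<lambda>B. B \<union> U"])
    show "(\<lambda>B. B \<union> U) ` {B. B \<subseteq> - U \<and> card B = k - card U} \<subseteq> {S. card S = k \<and> U \<subseteq> S}"
    proof clarify
      fix B assume "B \<subseteq> - U" "card B = k - card U"
      then show "card (B \<union> U) = k \<and> U \<subseteq> B \<union> U"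
        using assms by (subst card_Un_disjoint) auto
    qed
  qed (auto simp: card_Diff_subset)
  then have "card {S. card S = k \<and> U \<subseteq> S} = card {B. B \<subseteq> - U \<and> card B = k - card U}"
    by (rule bij_betw_same_card)
  also have "\<dots> = (CARD('n) - card U) choose (k - card U)"
    by (simp add: n_subsets card_Compl)
  finally show ?thesis .
qed

text \<open>Each product over \<open>S\<close> expands over the sets \<open>U\<close> of factors
  that contribute \<open>x i\<close>. A set \<open>U\<close> of size \<open>j\<close> lies in
  \<open>(n - j) choose (k - j)\<close> sets of size \<open>k\<close>, where \<open>n\<close> is the
  number of variables.\<close>

lemma esym_shift:
  fixes x :: "'n::finite \<Rightarrow> 'a::comm_semiring_1"
  shows "esym k (\<lambda>i. x i + c) =
     (\<Sum>j\<le>k. of_nat ((CARD('n) - j) choose (k - j)) * c ^ (k - j) * esym j x)"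
proof -
  have "esym k (\<lambda>i. x i + c) = (\<Sum>S | card S = k. \<Sum>U | U \<subseteq> S. (\<Prod>i\<in>U. x i) * c ^ (k - card U))"
    unfolding esym_def
  proof (intro sum.cong refl)
    fix S :: "'n set" assume "S \<in> {S. card S = k}"
    then show "(\<Prod>i\<in>S. x i + c) = (\<Sum>U | U \<subseteq> S. (\<Prod>i\<in>U. x i) * c ^ (k - card U))"
      by (subst prod_add) (auto simp: Pow_def card_Diff_subset intro!: sum.cong)
  qed
  also have "\<dots> = (\<Sum>U\<in>UNIV. \<Sum>S | card S = k \<and> U \<subseteq> S. (\<Prod>i\<in>U. x i) * c ^ (k - card U))"
    using sum.swap_restrict[of "{S::'n set. card S = k}" "UNIV :: 'n set set"
        "\<lambda>S U. (\<Prod>i\<in>U. x i) * c ^ (k - card U)" "\<lambda>S U. U \<subseteq> S"] by simp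
  \<comment> \<open>Sets larger than \<open>k\<close> have no superset of size \<open>k\<close>;
    without them the subtraction \<open>k - card U\<close> is exact.\<close>
  also have "\<dots> = (\<Sum>U | card U \<le> k. \<Sum>S | card S = k \<and> U \<subseteq> S. (\<Prod>i\<in>U. x i) * c ^ (k - card U))"
  proof (rule sum.mono_neutral_right)
    have "{S. card S = k \<and> U \<subseteq> S} = {}" if "\<not> card U \<le> k" for U :: "'n set"
      using that card_mono[of "_ :: 'n set" U] by auto
    then show "\<forall>U\<in>UNIV - {U. card U \<le> k}.
        (\<Sum>S | card S = k \<and> U \<subseteq> S. (\<Prod>i\<in>U. x i) * c ^ (k - card U)) = 0"
      by (metis (no_types, lifting) DiffE mem_Collect_eq sum.empty)
  qed auto
  also have "\<dots> = (\<Sum>U | card U \<le> k.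
      of_nat ((CARD('n) - card U) choose (k - card U)) * c ^ (k - card U) * (\<Prod>i\<in>U. x i))"
    by (intro sum.cong refl) (simp add: card_supersets mult.assoc mult.commute mult.left_commute)
  also have "\<dots> = (\<Sum>j\<le>k. \<Sum>U | U \<in> {U. card U \<le> k} \<and> card U = j.
      of_nat ((CARD('n) - card U) choose (k - card U)) * c ^ (k - card U) * (\<Prod>i\<in>U. x i))"
    by (rule sum.group[symmetric]) auto
  also have "\<dots> = (\<Sum>j\<le>k. \<Sum>U | card U = j.
      of_nat ((CARD('n) - j) choose (k - j)) * c ^ (k - j) * (\<Prod>i\<in>U. x i))"
    by (intro sum.cong refl) auto
  finally show ?thesis
    by (simp add: esym_def sum_distrib_left)
qed

text \<open>Vieta's formula, read from the top coefficient downwards: taking \<open>- x i\<close>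
  for the indices in \<open>U\<close> and the variable for the others gives a monomial of degree
  \<open>n - card U\<close>.\<close>

lemma coeff_prod_linear:
  fixes x :: "'n::finite \<Rightarrow> 'a::comm_ring_1"
  assumes "k \<le> CARD('n)"
  shows "coeff (\<Prod>i\<in>UNIV. [:- x i, 1:]) (CARD('n) - k) = (-1) ^ k * esym k x"
proof -
  have const: "(\<Prod>i\<in>U. [:f i:]) = [:\<Prod>i\<in>U. f i:]" for U and f :: "'n \<Rightarrow> 'a"
    by (induction U rule: infinite_finite_induct) (auto simp: one_pCons)
  have "(\<Prod>i\<in>UNIV. [:- x i, 1:]) = (\<Prod>i\<in>UNIV. [:- x i:] + monom 1 1)"
    by (simp add: monom_altdef)
  also have "\<dots> = (\<Sum>U\<in>UNIV. (\<Prod>i\<in>U. [:- x i:]) * monom 1 (CARD('n) - card U))"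
    by (subst prod_add) (auto simp: monom_power card_Compl Compl_eq_Diff_UNIV[symmetric])
  also have "\<dots> = (\<Sum>U\<in>UNIV. monom (\<Prod>i\<in>U. - x i) (CARD('n) - card U))"
    by (simp add: const smult_monom)
  finally have expand: "(\<Prod>i\<in>UNIV. [:- x i, 1:]) =
      (\<Sum>U\<in>UNIV. monom (\<Prod>i\<in>U. - x i) (CARD('n) - card U))" .
  have "CARD('n) - card U = CARD('n) - k \<longleftrightarrow> card U = k" for U :: "'n set"
    using assms card_mono[of UNIV U] by auto
  then have "coeff (\<Prod>i\<in>UNIV. [:- x i, 1:]) (CARD('n) - k) =
      (\<Sum>U\<in>UNIV. if card U = k then (-1) ^ k * (\<Prod>i\<in>U. x i) else 0)"
    unfolding expand coeff_sum by (intro sum.cong refl) (simp add: prod_uminus)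
  also have "\<dots> = (-1) ^ k * esym k x"
    by (simp add: esym_def sum_distrib_left sum.If_cases)
  finally show ?thesis .
qed

section \<open>Diagonal operators\<close>

text \<open>The positions of the free diagonal entries. The index 1 is missing because the
  coefficient of degree \<open>n - 1\<close> is zero on the domain.\<close>

definition diag_indices :: "nat \<Rightarrow> nat \<Rightarrow> nat set" where
  "diag_indices n d = {j. j \<le> n \<and> j \<le> d \<and> j \<noteq> 1}"

text \<open>\<open>restrict\<close> makes the map extensional, so two such operators are equal as
  functions once their entries on \<open>diag_indices\<close> agree.\<close>

definition diag_op :: "nat \<Rightarrow> nat \<Rightarrow> (nat \<Rightarrow> real) \<Rightarrow> real poly \<Rightarrow> real poly" where
  "diag_op n d \<gamma> = restrict
     (\<lambda>g. \<Sum>j\<in>diag_indices n d. monom (\<gamma> j * coeff g (n - j)) (d - j)) (zero_sum_polys n)"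

lemma finite_diag_indices [simp]: "finite (diag_indices n d)"
  by (simp add: diag_indices_def)

text \<open>Only the summand with \<open>j = d - l\<close> reaches degree \<open>l\<close>. The
  condition \<open>l \<le> d\<close> stops truncated subtraction from producing the index 0
  instead.\<close>

lemma coeff_diag_op:
  assumes "g \<in> zero_sum_polys n"
  shows "coeff (diag_op n d \<gamma> g) l =
    (if l \<le> d \<and> d - l \<in> diag_indices n d then \<gamma> (d - l) * coeff g (n - (d - l)) else 0)"
proof -
  have "coeff (diag_op n d \<gamma> g) l =
      (\<Sum>j\<in>diag_indices n d. if j = d - l \<and> l \<le> d then \<gamma> j * coeff g (n - j) else 0)"
    using assms unfolding diag_op_def
    by (auto simp: coeff_sum diag_indices_def intro!: sum.cong)
  then show ?thesis
    by (cases "l \<le> d") (auto simp: sum.delta)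
qed

lemma zero_sum_polys_0: "0 \<in> zero_sum_polys n"
  by (simp add: zero_sum_polys_def)

lemma zero_sum_polys_add: "f \<in> zero_sum_polys n \<Longrightarrow> g \<in> zero_sum_polys n \<Longrightarrow> f + g \<in> zero_sum_polys n"
  by (auto simp: zero_sum_polys_def degree_add_le)

lemma zero_sum_polys_smult: "g \<in> zero_sum_polys n \<Longrightarrow> smult c g \<in> zero_sum_polys n"
  by (auto simp: zero_sum_polys_def)

lemma zero_sum_polys_monom: "k \<le> n \<Longrightarrow> k \<noteq> 1 \<Longrightarrow> monom c (n - k) \<in> zero_sum_polys n"
  by (auto simp: zero_sum_polys_def intro: order.trans[OF degree_monom_le])

lemma zero_sum_polys_sum:
  "(\<And>i. i \<in> A \<Longrightarrow> f i \<in> zero_sum_polys n) \<Longrightarrow> (\<Sum>i\<in>A. f i) \<in> zero_sum_polys n"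
  by (induction A rule: infinite_finite_induct) (auto simp: zero_sum_polys_0 zero_sum_polys_add)

lemma diag_op_in_zero_sum_polys: "g \<in> zero_sum_polys n \<Longrightarrow> diag_op n d \<gamma> g \<in> zero_sum_polys d"
  unfolding diag_op_def restrict_def
  by (auto intro!: zero_sum_polys_sum zero_sum_polys_monom simp: diag_indices_def)

lemma diag_op_linear_maps: "diag_op n d \<gamma> \<in> linear_maps n d"
  unfolding linear_maps_def
proof (intro CollectI conjI ballI allI)
  show "diag_op n d \<gamma> \<in> zero_sum_polys n \<rightarrow>\<^sub>E zero_sum_polys d"
    using diag_op_in_zero_sum_polys[of _ n d \<gamma>] by (auto simp: diag_op_def)
qed (auto simp: poly_eq_iff coeff_diag_op zero_sum_polys_add zero_sum_polys_smult algebra_simps)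

lemma diag_op_monom:
  assumes "k \<le> n" "k \<noteq> 1"
  shows "diag_op n d \<gamma> (monom 1 (n - k)) = (if k \<le> d then smult (\<gamma> k) (monom 1 (d - k)) else 0)"
  using assms
  by (auto simp: poly_eq_iff coeff_diag_op zero_sum_polys_monom diag_indices_def eq_diff_iff)

text \<open>For \<open>d = 0\<close> the index 1 would satisfy \<open>k > d\<close>, and
  \<open>diagonal\<close> would prescribe a value at the monomial of degree \<open>n - 1\<close>,
  which lies outside the domain.\<close>

lemma diag_op_diagonal_maps: "d \<ge> 1 \<Longrightarrow> diag_op n d \<gamma> \<in> diagonal_maps n d"
  unfolding diagonal_maps_def diagonal_def
  by (auto simp: diag_op_linear_maps diag_op_monom intro!: exI[of _ \<gamma>])

lemma linear_maps_sum:
  assumes "T \<in> linear_maps n d" and "\<And>i. i \<in> A \<Longrightarrow> f i \<in> zero_sum_polys n"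
  shows "T (\<Sum>i\<in>A. smult (c i) (f i)) = (\<Sum>i\<in>A. smult (c i) (T (f i)))"
proof -
  have add: "T (f + g) = T f + T g" if "f \<in> zero_sum_polys n" "g \<in> zero_sum_polys n" for f g
    using assms(1) that by (auto simp: linear_maps_def)
  have smult: "T (smult c g) = smult c (T g)" if "g \<in> zero_sum_polys n" for c g
    using assms(1) that by (auto simp: linear_maps_def)
  have "T 0 = 0"
    using smult[OF zero_sum_polys_0, of 0] by simp
  with assms(2) show ?thesis
    by (induction A rule: infinite_finite_induct)
       (auto simp: add smult zero_sum_polys_sum zero_sum_polys_smult)
qed

lemma zero_sum_polys_expand:
  assumes "g \<in> zero_sum_polys n"
  shows "g = (\<Sum>j | j \<le> n \<and> j \<noteq> 1. smult (coeff g (n - j)) (monom 1 (n - j)))"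
proof (rule poly_eqI)
  fix l
  have "coeff (\<Sum>j | j \<le> n \<and> j \<noteq> 1. smult (coeff g (n - j)) (monom 1 (n - j))) l =
     (\<Sum>j | j \<le> n \<and> j \<noteq> 1. if j = n - l \<and> l \<le> n then coeff g (n - j) else 0)"
    by (auto simp: coeff_sum intro!: sum.cong)
  also have "\<dots> = (if l \<le> n \<and> n - l \<noteq> 1 then coeff g l else 0)"
    by (cases "l \<le> n") (auto simp: sum.delta)
  also have "\<dots> = coeff g l"
  proof -
    have "coeff g l = 0" if "n - l = 1"
    proof -
      have "l = n - 1" "n \<ge> 1" using that by auto
      then show ?thesis using assms by (auto simp: zero_sum_polys_def)
    qed
    moreover have "coeff g l = 0" if "\<not> l \<le> n"
      using that assms by (intro coeff_eq_0) (auto simp: zero_sum_polys_def)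
    ultimately show ?thesis by auto
  qed
  finally show "coeff g l = coeff (\<Sum>j | j \<le> n \<and> j \<noteq> 1. smult (coeff g (n - j)) (monom 1 (n - j))) l"
    by simp
qed

text \<open>A linear map is fixed by its values on the monomials of the domain, which
  \<open>diagonal\<close> prescribes; extensionality settles all other arguments.\<close>

lemma diagonal_maps_imp_diag_op:
  assumes "T \<in> diagonal_maps n d"
  shows "\<exists>\<gamma>. T = diag_op n d \<gamma>"
proof -
  from assms have lin: "T \<in> linear_maps n d"
    by (simp add: diagonal_maps_def)
  from assms obtain \<gamma> where
    \<gamma>: "\<And>k. k \<le> n \<Longrightarrow> k \<le> d \<Longrightarrow> k \<noteq> 1 \<Longrightarrow> T (monom 1 (n - k)) = smult (\<gamma> k) (monom 1 (d - k))" and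
    0: "\<And>k. k \<le> n \<Longrightarrow> k > d \<Longrightarrow> T (monom 1 (n - k)) = 0"
    by (auto simp: diagonal_maps_def diagonal_def)
  have "T g = diag_op n d \<gamma> g" if g: "g \<in> zero_sum_polys n" for g
  proof -
    have "T g = T (\<Sum>j | j \<le> n \<and> j \<noteq> 1. smult (coeff g (n - j)) (monom 1 (n - j)))"
      using zero_sum_polys_expand[OF g] by simp
    also have "\<dots> = (\<Sum>j | j \<le> n \<and> j \<noteq> 1. smult (coeff g (n - j)) (T (monom 1 (n - j))))"
      by (rule linear_maps_sum[OF lin]) (auto intro: zero_sum_polys_monom)
    also have "\<dots> = (\<Sum>j\<in>diag_indices n d. smult (coeff g (n - j)) (T (monom 1 (n - j))))"
      by (rule sum.mono_neutral_right) (use 0 in \<open>auto simp: diag_indices_def not_le[symmetric]\<close>)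
    also have "\<dots> = (\<Sum>j\<in>diag_indices n d. monom (\<gamma> j * coeff g (n - j)) (d - j))"
      by (intro sum.cong refl) (auto simp: diag_indices_def \<gamma> smult_monom mult.commute)
    finally show ?thesis
      using g by (simp add: diag_op_def)
  qed
  moreover have "T g = diag_op n d \<gamma> g" if "g \<notin> zero_sum_polys n" for g
    using that lin by (auto simp: linear_maps_def diag_op_def PiE_def extensional_def)
  ultimately show ?thesis
    by blast
qed

lemma diag_op_eq_iff: "diag_op n d \<gamma> = diag_op n d \<gamma>' \<longleftrightarrow> (\<forall>j\<in>diag_indices n d. \<gamma> j = \<gamma>' j)"
proof
  assume eq: "diag_op n d \<gamma> = diag_op n d \<gamma>'"
  show "\<forall>j\<in>diag_indices n d. \<gamma> j = \<gamma>' j"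
  proof
    fix j assume "j \<in> diag_indices n d"
    then have "j \<le> n" "j \<le> d" "j \<noteq> 1" by (auto simp: diag_indices_def)
    with arg_cong[OF fun_cong[OF eq, of "monom 1 (n - j)"], of "\<lambda>p. coeff p (d - j)"]
    show "\<gamma> j = \<gamma>' j"
      by (simp add: diag_op_monom)
  qed
qed (auto simp: diag_op_def intro!: restrict_ext sum.cong)

section \<open>Diagonal entries of the associated operator and their triangular system\<close>

text \<open>The diagonal entry of index \<open>j\<close> as a linear form in \<open>a\<close>. The
  power of \<open>n\<close> stems from \<open>e_1(r - t) = - n t\<close>, the binomial from
  translating \<open>e_i\<close>, and \<open>(-1) ^ d\<close> is the sign left once that of Vieta's
  formula is split off.\<close>

definition hook_weight :: "nat \<Rightarrow> nat \<Rightarrow> (nat \<Rightarrow> real) \<Rightarrow> nat \<Rightarrow> real" where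
  "hook_weight n d a j =
     (-1) ^ d * (\<Sum>i=1..d. if j \<le> i then a i * real n ^ (d - i) * real ((n - j) choose (i - j)) else 0)"

text \<open>The zero coefficient of degree \<open>n - 1\<close> forces \<open>E 1 = 0\<close>. This
  removes the index 1 and reduces \<open>e_1(r - t)\<close> to \<open>- n t\<close>, so that every
  term with \<open>E j\<close> carries the same power \<open>t ^ (d - j)\<close>.\<close>

lemma diag_op_root_formula:
  fixes r :: "complex ^ 'n::finite" and a :: real
  assumes g: "g \<in> zero_sum_polys CARD('n)" and "a \<noteq> 0"
    and roots: "map_poly complex_of_real g = smult (complex_of_real a) (\<Prod>i\<in>UNIV. [:- (r $ i), 1:])"
  shows "poly (map_poly complex_of_real (diag_op CARD('n) d (hook_weight CARD('n) d b) g)) t =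
     complex_of_real a * eval_complex (hook d b) (r - t *s 1)"
proof -
  let ?n = "CARD('n)" and ?J = "diag_indices CARD('n) d"
  define E where "E j = esym j (\<lambda>i. r $ i)" for j
  have coeff: "complex_of_real (coeff g (?n - j)) = complex_of_real a * (-1) ^ j * E j" if "j \<le> ?n" for j
    using arg_cong[OF roots, of "\<lambda>p. coeff p (?n - j)"] coeff_prod_linear[OF that, of "\<lambda>i. r $ i"]
    by (simp add: coeff_map_poly E_def)
  have E1: "E 1 = 0"
  proof -
    have "?n \<ge> 1" by simp
    then show ?thesis
      using coeff[of 1] g \<open>a \<noteq> 0\<close> by (simp add: zero_sum_polys_def)
  qed
  \<comment> \<open>The indices dropped are 1, where \<open>E\<close> vanishes, and those above
    \<open>n\<close>, where no set has that size.\<close>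
  have sum_E: "(\<Sum>j\<le>i. f j * E j) = (\<Sum>j\<in>?J. if j \<le> i then f j * E j else 0)" if "i \<le> d" for f i
  proof -
    have "(\<Sum>j\<le>i. f j * E j) = (\<Sum>j | j \<in> ?J \<and> j \<le> i. f j * E j)"
    proof (rule sum.mono_neutral_right)
      show "\<forall>j\<in>{..i} - {j \<in> ?J. j \<le> i}. f j * E j = 0"
        using that E1 esym_eq_0[where 'n = 'n, of _ "\<lambda>i. r $ i"]
        by (auto simp: diag_indices_def E_def not_le[symmetric])
    qed auto
    then show ?thesis
      by (simp add: sum.inter_filter)
  qed
  have shift: "esym i (\<lambda>k. (r - t *s 1) $ k) = (\<Sum>j\<le>i. of_nat ((?n - j) choose (i - j)) * (- t) ^ (i - j) * E j)" for i
    using esym_shift[of i "\<lambda>k. r $ k" "- t"] by (simp add: E_def vector_scalar_mult_def)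
  have e1: "esym 1 (\<lambda>k. (r - t *s 1) $ k) = - (of_nat ?n * t)"
    using E1 by (simp add: E_def esym_1[unfolded One_nat_def] sum_subtractf vector_scalar_mult_def)
  have "eval_complex (hook d b) (r - t *s 1) =
      (\<Sum>i=1..d. complex_of_real (b i) * (- (of_nat ?n * t)) ^ (d - i) *
         (\<Sum>j\<le>i. of_nat ((?n - j) choose (i - j)) * (- t) ^ (i - j) * E j))"
    unfolding complex_hom.mp_eval_hook e1 unfolding shift ..
  also have "\<dots> = (\<Sum>i=1..d. \<Sum>j\<in>?J. if j \<le> i then complex_of_real (b i) * (- (of_nat ?n * t)) ^ (d - i) *
         (of_nat ((?n - j) choose (i - j)) * (- t) ^ (i - j) * E j) else 0)"
    by (intro sum.cong refl) (simp add: sum_E sum_distrib_left if_distrib cong: if_cong)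
  also have "\<dots> = (\<Sum>i=1..d. \<Sum>j\<in>?J. complex_of_real
      (if j \<le> i then (-1) ^ d * (b i * real ?n ^ (d - i) * real ((?n - j) choose (i - j))) else 0)
      * (-1) ^ j * E j * t ^ (d - j))"
  proof (intro sum.cong refl)
    fix i j assume "i \<in> {1..d}" "j \<in> ?J"
    then have id: "i \<le> d" by simp
    have "(- (of_nat ?n * t)) ^ (d - i) * (- t) ^ (i - j) =
        of_nat ?n ^ (d - i) * ((-1) ^ d * (-1) ^ j) * t ^ (d - j)" if "j \<le> i"
    proof -
      have "d - j = (d - i) + (i - j)" using id that by simp
      \<comment> \<open>The sign is split because \<open>(-1) ^ d\<close> belongs to the weight and
        \<open>(-1) ^ j\<close> to the coefficient of \<open>g\<close>.\<close>
      moreover have "(-1) ^ d = ((-1) ^ (d - j) * (-1) ^ j :: complex)"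
        using id that by (simp flip: power_add)
      ultimately show ?thesis
        by (simp add: power_add power_minus[of t] power_minus[of "of_nat ?n * t"] power_mult_distrib mult.assoc)
    qed
    then show "(if j \<le> i then complex_of_real (b i) * (- (of_nat ?n * t)) ^ (d - i) *
         (of_nat ((?n - j) choose (i - j)) * (- t) ^ (i - j) * E j) else 0) =
       complex_of_real
      (if j \<le> i then (-1) ^ d * (b i * real ?n ^ (d - i) * real ((?n - j) choose (i - j))) else 0)
      * (-1) ^ j * E j * t ^ (d - j)"
      by (simp add: ac_simps)
  qed
  also have "\<dots> = (\<Sum>j\<in>?J. complex_of_real (hook_weight ?n d b j) * (-1) ^ j * E j * t ^ (d - j))"
    unfolding hook_weight_def
    by (subst sum.swap) (simp add: sum_distrib_left sum_distrib_right if_distrib cong: if_cong)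
  finally have "complex_of_real a * eval_complex (hook d b) (r - t *s 1) =
      (\<Sum>j\<in>?J. complex_of_real (hook_weight ?n d b j) * (complex_of_real a * (-1) ^ j * E j) * t ^ (d - j))"
    by (simp add: sum_distrib_left ac_simps)
  also have "\<dots> = (\<Sum>j\<in>?J. complex_of_real (hook_weight ?n d b j * coeff g (?n - j)) * t ^ (d - j))"
    by (intro sum.cong refl) (auto simp: diag_indices_def coeff)
  also have "\<dots> = poly (map_poly complex_of_real (diag_op ?n d (hook_weight ?n d b) g)) t"
    using g by (simp add: diag_op_def map_poly_of_real_sum map_poly_monom poly_sum poly_monom)
  finally show ?thesis ..
qed

text \<open>
  The diagonal of the triangular system: the weight with index \<open>i\<close> belongs to \<open>a i\<close>, except that
  the weight with index \<open>0\<close> belongs to \<open>a 1\<close>. The index \<open>j\<close> thus belongs to \<open>a (max j 1)\<close>.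
\<close>

lemma binomial_nonzero_index:
  assumes "1 \<le> i" "i \<le> d" "i \<le> n"
  obtains j where "j \<in> diag_indices n d" "max j 1 = i" "real ((n - j) choose (i - j)) \<noteq> 0"
proof (cases "i = 1")
  case True
  then show ?thesis using that[of 0] assms by (auto simp: diag_indices_def)
next
  case False
  then show ?thesis using that[of i] assms by (auto simp: diag_indices_def max_def)
qed

text \<open>Triangularity: altering \<open>a i\<close> leaves the weights of index above
  \<open>i\<close> alone.\<close>

lemma hook_weight_fun_upd:
  assumes "1 \<le> i" "i \<le> d"
  shows "hook_weight n d (a(i := v)) j = hook_weight n d a j +
    (if j \<le> i then (-1) ^ d * ((v - a i) * real n ^ (d - i) * real ((n - j) choose (i - j))) else 0)"
proof -
  have "(\<Sum>k=1..d. if j \<le> k then (a(i := v)) k * real n ^ (d - k) * real ((n - j) choose (k - j)) else 0) =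
     (\<Sum>k=1..d. (if j \<le> k then a k * real n ^ (d - k) * real ((n - j) choose (k - j)) else 0) +
       (if k = i then if j \<le> i then (v - a i) * real n ^ (d - i) * real ((n - j) choose (i - j)) else 0 else 0))"
    by (intro sum.cong) (auto simp: algebra_simps)
  also have "\<dots> = (\<Sum>k=1..d. if j \<le> k then a k * real n ^ (d - k) * real ((n - j) choose (k - j)) else 0) +
       (if j \<le> i then (v - a i) * real n ^ (d - i) * real ((n - j) choose (i - j)) else 0)"
    using assms by (simp add: sum.distrib)
  finally show ?thesis
    by (simp add: hook_weight_def distrib_left)
qed

text \<open>Back substitution from the highest index down. Each stage adjusts one coefficient to
  satisfy one more equation and, by triangularity, keeps those already solved.\<close>

lemma hook_weight_surj:
  assumes "n \<ge> 1" "d \<ge> 1"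
  shows "\<exists>a. \<forall>j\<in>diag_indices n d. hook_weight n d a j = \<gamma> j"
proof -
  \<comment> \<open>After \<open>l\<close> stages the equations whose unknown has an index above
    \<open>d - l\<close> hold.\<close>
  have "\<exists>a. \<forall>j\<in>diag_indices n d. max j 1 + l > d \<longrightarrow> hook_weight n d a j = \<gamma> j" for l
  proof (induction l)
    case 0
    show ?case using assms by (auto simp: diag_indices_def)
  next
    case (Suc l)
    then obtain a where a: "\<And>j. j \<in> diag_indices n d \<Longrightarrow> max j 1 + l > d \<Longrightarrow> hook_weight n d a j = \<gamma> j"
      by blast
    define i where "i = d - l"
    show ?case
    proof (cases "1 \<le> i \<and> i \<le> n")
      \<comment> \<open>No equation has its unknown at \<open>i\<close>, which is either 0 or
        greater than \<open>n\<close>.\<close>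
      case False
      have "max j 1 + l > d" if "j \<in> diag_indices n d" "max j 1 + Suc l > d" for j
        using that False assms by (auto simp: diag_indices_def i_def max_def split: if_splits)
      with a show ?thesis by blast
    next
      case True
      then have i: "1 \<le> i" "i \<le> d" "i \<le> n" "d = i + l" by (auto simp: i_def)
      obtain k where k: "k \<in> diag_indices n d" "max k 1 = i" "real ((n - k) choose (i - k)) \<noteq> 0"
        using binomial_nonzero_index[OF i(1-3)] .
      define C where "C = (-1) ^ d * (real n ^ (d - i) * real ((n - k) choose (i - k)))"
      have "C \<noteq> 0" using k(3) assms by (simp add: C_def)
      \<comment> \<open>The value of \<open>a i\<close> that solves equation \<open>k\<close>, in
        which it enters with slope \<open>C\<close>.\<close>
      define v where "v = a i + (\<gamma> k - hook_weight n d a k) / C"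
      have "hook_weight n d (a(i := v)) j = \<gamma> j" if "j \<in> diag_indices n d" "max j 1 + Suc l > d" for j
      proof (cases "j = k")
        case True
        have "(-1) ^ d * ((v - a i) * real n ^ (d - i) * real ((n - k) choose (i - k))) = (v - a i) * C"
          by (simp add: C_def)
        then have "hook_weight n d (a(i := v)) k = hook_weight n d a k + (v - a i) * C"
          using hook_weight_fun_upd[OF i(1,2), of n a v k] k(2) by auto
        with True \<open>C \<noteq> 0\<close> show ?thesis by (simp add: v_def)
      next
        case False
        \<comment> \<open>The indices 0 and 1 would share the unknown \<open>a 1\<close>, but 1 is
          not in \<open>diag_indices\<close>; so every other equation in range lies above
          \<open>i\<close>.\<close>
        then have "j > i"
          using that k(1,2) i by (auto simp: diag_indices_def max_def split: if_splits)
        then show ?thesis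
          using hook_weight_fun_upd[OF i(1,2), of n a v j] a[OF that(1)] i by auto
      qed
      then show ?thesis by blast
    qed
  qed
  from this[of d] show ?thesis
    by (simp add: less_max_iff_disj)
qed

text \<open>Take the largest index \<open>m \<le> n\<close> where the sequences differ. Apart from
  the coefficient at \<open>m\<close>, the equation belonging to \<open>m\<close> involves only
  coefficients that agree or whose binomial is zero.\<close>

lemma hook_weight_inj:
  assumes "n \<ge> 1" and eq: "\<forall>j\<in>diag_indices n d. hook_weight n d a j = hook_weight n d b j"
    and "1 \<le> i" "i \<le> d" "i \<le> n"
  shows "a i = b i"
proof (rule ccontr)
  assume "a i \<noteq> b i"
  define D where "D = {i. 1 \<le> i \<and> i \<le> d \<and> i \<le> n \<and> a i \<noteq> b i}"
  define m where "m = Max D"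
  have D: "finite D" "D \<noteq> {}"
    using assms \<open>a i \<noteq> b i\<close> by (auto simp: D_def)
  then have "m \<in> D" by (simp add: m_def)
  then have m: "1 \<le> m" "m \<le> d" "m \<le> n" "a m \<noteq> b m" by (auto simp: D_def)
  have above: "a k = b k" if "m < k" "k \<le> d" "k \<le> n" for k
  proof -
    have "k \<notin> D"
      using that(1) Max_ge[OF D(1), of k] by (auto simp: m_def)
    then show ?thesis using that m(1) by (auto simp: D_def)
  qed
  obtain j where j: "j \<in> diag_indices n d" "max j 1 = m" "real ((n - j) choose (m - j)) \<noteq> 0"
    using binomial_nonzero_index[OF m(1-3)] .
  have "hook_weight n d a j = hook_weight n d (b(m := a m)) j"
    unfolding hook_weight_def
  proof (intro arg_cong2[where f = "(*)"] sum.cong refl)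
    fix k assume k: "k \<in> {1..d}"
    consider "j \<le> k" "k > n" | "j \<le> k" "k \<le> n" "k \<ge> m" | "k < j"
      using k j(2) by (auto simp: max_def not_le split: if_splits) linarith+
    then show "(if j \<le> k then a k * real n ^ (d - k) * real ((n - j) choose (k - j)) else 0) =
       (if j \<le> k then (b(m := a m)) k * real n ^ (d - k) * real ((n - j) choose (k - j)) else 0)"
    proof cases
      case 1
      \<comment> \<open>The binomial vanishes for \<open>k > n\<close>, just as
        \<open>elem_sym k\<close> does.\<close>
      then have "(n - j) choose (k - j) = 0"
        using j(1) by (intro binomial_eq_0) (auto simp: diag_indices_def)
      then show ?thesis by simp
    next
      case 2
      then show ?thesis using above[of k] k by auto
    qed auto
  qed
  also have "\<dots> = hook_weight n d b j + (-1) ^ d * ((a m - b m) * real n ^ (d - m) * real ((n - j) choose (m - j)))"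
    using hook_weight_fun_upd[OF m(1,2), of n b "a m" j] j(2) by auto
  finally show False
    using eq j(1,3) m(4) assms(1) by auto
qed

text \<open>The weights fix \<open>a i\<close> for \<open>i\<close> up to the number of variables;
  the remaining coefficients multiply \<open>elem_sym i = 0\<close>.\<close>

lemma hook_cong_weight:
  assumes "\<forall>j\<in>diag_indices CARD('n) d. hook_weight CARD('n) d a j = hook_weight CARD('n) d b j"
  shows "(hook d a :: 'n::finite mpol) = hook d b"
  unfolding hook_def
proof (intro sum.cong refl)
  fix i assume i: "i \<in> {1..d}"
  show "(Const (a i) * elem_sym 1 ^ (d - i) * elem_sym i :: 'n mpol) = Const (b i) * elem_sym 1 ^ (d - i) * elem_sym i"
  proof (cases "i \<le> CARD('n)")
    case True
    then show ?thesis
      using hook_weight_inj[OF _ assms, of i] i by simp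
  next
    case False
    then show ?thesis
      by (simp add: elem_sym_eq_0)
  qed
qed

section \<open>Coefficientwise limits\<close>

lemma coeff_tendsto_unique: "coeff_tendsto G f \<Longrightarrow> coeff_tendsto G g \<Longrightarrow> f = g"
  unfolding coeff_tendsto_def poly_eq_iff by (blast intro: LIMSEQ_unique)

lemma coeff_tendsto_mult: "coeff_tendsto F f \<Longrightarrow> coeff_tendsto G g \<Longrightarrow> coeff_tendsto (\<lambda>k. F k * G k) (f * g)"
  by (auto simp: coeff_tendsto_def coeff_mult intro!: tendsto_intros)

lemma coeff_tendsto_const: "coeff_tendsto (\<lambda>k. f) f"
  by (simp add: coeff_tendsto_def)

lemma coeff_tendsto_prod:
  "(\<And>i. i \<in> A \<Longrightarrow> coeff_tendsto (\<lambda>k. F k i) (f i)) \<Longrightarrow> coeff_tendsto (\<lambda>k. \<Prod>i\<in>A. F k i) (\<Prod>i\<in>A. f i)"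
  by (induction A rule: infinite_finite_induct) (auto simp: coeff_tendsto_const coeff_tendsto_mult)

lemma coeff_continuousD:
  assumes "coeff_continuous n T" "\<And>k. G k \<in> zero_sum_polys n" "g \<in> zero_sum_polys n" "coeff_tendsto G g"
  shows "coeff_tendsto (\<lambda>k. T (G k)) (T g)"
  using assms by (simp add: coeff_continuous_def)

lemma coeff_continuous_diag_op: "coeff_continuous n (diag_op n d \<gamma>)"
  unfolding coeff_continuous_def coeff_tendsto_def
  by (auto simp: coeff_diag_op intro!: tendsto_intros)

section \<open>Roots indexed by variables and uniqueness of the associated operator\<close>

text \<open>Turns the multiset of roots of a polynomial into an indexed family that respects
  multiplicities.\<close>

lemma multiset_eq_image_mset_set:
  assumes "finite A" "size M = card A"
  shows "\<exists>r. image_mset r (mset_set A) = M"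
  using assms
proof (induction A arbitrary: M rule: finite_induct)
  case empty
  then show ?case by simp
next
  case (insert x A M)
  then have "size M = Suc (card A)" by simp
  then obtain y N where M: "M = add_mset y N"
    using size_eq_Suc_imp_eq_union by blast
  with \<open>size M = Suc (card A)\<close> have "size N = card A" by simp
  from insert.IH[OF this] obtain r where r: "image_mset r (mset_set A) = N" by blast
  have "image_mset (r(x := y)) (mset_set A) = image_mset r (mset_set A)"
    using insert.hyps(1,2) by (intro image_mset_cong) auto
  then have "image_mset (r(x := y)) (mset_set (insert x A)) = M"
    by (simp add: insert.hyps(1,2) r M)
  then show ?case by (rule exI[where x = "r(x := y)"])
qed

text \<open>The complement of \<open>A\<close> leaves room for the roots that a polynomial of degree
  below \<open>n\<close> lacks.\<close>

lemma complex_poly_indexed_factorization: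
  fixes p :: "complex poly"
  assumes "p \<noteq> 0" "degree p \<le> CARD('n::finite)"
  shows "\<exists>(A :: 'n set) r. card A = degree p \<and> p = smult (lead_coeff p) (\<Prod>i\<in>A. [:- r i, 1:])"
proof -
  obtain A :: "'n set" where A: "card A = degree p"
    using obtain_subset_with_card_n[OF assms(2)] by blast
  obtain M where M: "size M = degree p" "p = smult (lead_coeff p) (\<Prod>x\<in>#M. [:- x, 1:])"
    using alg_closed_imp_factorization[OF assms(1)] by blast
  have "size M = card A"
    by (simp only: A M(1))
  then obtain r where r: "image_mset r (mset_set A) = M"
    using multiset_eq_image_mset_set[of A M] finite[of A] by blast
  have eq: "(\<Prod>x\<in>#M. [:- x, 1:]) = (\<Prod>i\<in>A. [:- r i, 1:])"
    unfolding r[symmetric] by (simp add: prod_unfold_prod_mset image_mset.compositionality o_def)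
  show ?thesis
    by (intro exI conjI) (rule A, rule M(2)[unfolded eq])
qed

text \<open>In degree \<open>n\<close> the polynomial splits over the complex numbers, so the root
  formula fixes its image. Smaller degrees are limits of degree \<open>n\<close> within the space,
  and continuity transfers the equality.\<close>

lemma associated_operator_unique:
  fixes p :: "'n::finite mpol"
  assumes T: "is_associated_operator d p T" and U: "is_associated_operator d p U"
  shows "T = U"
proof -
  let ?Z = "zero_sum_polys CARD('n)"
  have generic: "T g = U g" if g: "g \<in> ?Z" and n: "coeff g CARD('n) \<noteq> 0" for g
  proof -
    have deg: "degree g = CARD('n)"
      using g n le_degree[OF n] by (auto simp: zero_sum_polys_def)
    let ?g = "map_poly complex_of_real g"
    have deg_g: "degree ?g = CARD('n)" and "?g \<noteq> 0"
      using deg n by (auto simp: degree_map_poly map_poly_eq_0_iff)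
    then obtain A :: "'n set" and r where A: "card A = degree ?g"
      "?g = smult (lead_coeff ?g) (\<Prod>i\<in>A. [:- r i, 1:])"
      using complex_poly_indexed_factorization[where 'n = 'n, OF \<open>?g \<noteq> 0\<close>] by fastforce
    have A_UNIV: "A = UNIV"
      using A(1) deg_g by (simp add: card_subset_eq)
    have lc: "lead_coeff ?g = complex_of_real (lead_coeff g)"
      using deg deg_g by (simp add: coeff_map_poly)
    have *: "?g = smult (complex_of_real (lead_coeff g)) (\<Prod>i\<in>UNIV. [:- (vec_lambda r $ i), 1:])"
      using A(2) by (simp only: lc A_UNIV vec_lambda_beta)
    have formula: "poly (map_poly complex_of_real (V g)) t =
        complex_of_real (lead_coeff g) * eval_complex p (vec_lambda r - t *s 1)"
      if V: "is_associated_operator d p V" for V t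
    proof -
      have "lead_coeff g \<noteq> 0"
        using n deg by simp
      with V g * show ?thesis
        unfolding is_associated_operator_def by (elim conjE) blast
    qed
    have "poly (map_poly complex_of_real (T g)) = poly (map_poly complex_of_real (U g))"
      by (rule ext) (simp only: formula[OF T] formula[OF U])
    then show ?thesis
      by (simp only: poly_eq_poly_eq_iff map_poly_of_real_eq_iff)
  qed
  have "T g = U g" if g: "g \<in> ?Z" for g
  proof (cases "coeff g CARD('n) = 0")
    case False
    then show ?thesis using generic g by blast
  next
    case True
    \<comment> \<open>A small multiple of the monomial of degree \<open>n\<close> raises the degree
      and keeps the coefficient of degree \<open>n - 1\<close> at zero.\<close>
    define G where "G k = g + monom (inverse (real (Suc k))) CARD('n)" for k
    have GZ: "G k \<in> ?Z" for k
      using zero_sum_polys_add[OF g zero_sum_polys_monom[of 0 "CARD('n)" "inverse (real (Suc k))"]]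
      by (simp add: G_def)
    have lim: "coeff_tendsto G g"
      unfolding coeff_tendsto_def
    proof
      fix i
      have "(\<lambda>k. if CARD('n) = i then inverse (real (Suc k)) else 0) \<longlonglongrightarrow> 0"
        using LIMSEQ_inverse_real_of_nat by (cases "CARD('n) = i") simp_all
      from tendsto_add[OF tendsto_const this]
      show "(\<lambda>k. coeff (G k) i) \<longlonglongrightarrow> coeff g i"
        by (simp add: G_def del: of_nat_Suc)
    qed
    have "T (G k) = U (G k)" for k
      using True by (intro generic GZ) (simp add: G_def)
    moreover have lim_V: "coeff_tendsto (\<lambda>k. V (G k)) (V g)" if "is_associated_operator d p V" for V
      using that by (intro coeff_continuousD[OF _ GZ g lim]) (simp add: is_associated_operator_def)
    ultimately have "coeff_tendsto (\<lambda>k. T (G k)) (U g)"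
      using lim_V[OF U] by simp
    with lim_V[OF T] show ?thesis
      by (rule coeff_tendsto_unique)
  qed
  moreover have "T \<in> extensional ?Z" "U \<in> extensional ?Z"
    using T U by (auto simp: is_associated_operator_def PiE_def)
  ultimately show ?thesis
    using extensionalityI[of T ?Z U] by blast
qed

lemma is_associated_operator_hook:
  "is_associated_operator d (hook d a :: 'n::finite mpol) (diag_op CARD('n) d (hook_weight CARD('n) d a))"
  unfolding is_associated_operator_def
proof (intro conjI ballI allI impI)
  show "diag_op CARD('n) d (hook_weight CARD('n) d a) \<in> zero_sum_polys CARD('n) \<rightarrow>\<^sub>E zero_sum_polys d"
    using diag_op_linear_maps[of "CARD('n)" d] by (simp only: linear_maps_def mem_Collect_eq)
qed (auto intro!: diag_op_root_formula coeff_continuous_diag_op)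

lemma associated_operator_hook:
  "associated_operator d (hook d a :: 'n::finite mpol) = diag_op CARD('n) d (hook_weight CARD('n) d a)"
  unfolding associated_operator_def
  by (intro the_equality is_associated_operator_hook)
     (rule associated_operator_unique[OF _ is_associated_operator_hook])

section \<open>Limits of real-rooted polynomials\<close>

lemma poly_map_poly_of_real_altdef:
  assumes "degree p \<le> d"
  shows "poly (map_poly complex_of_real p) z = (\<Sum>i\<le>d. complex_of_real (coeff p i) * z ^ i)"
proof -
  have "poly (map_poly complex_of_real p) z = (\<Sum>i\<le>degree p. complex_of_real (coeff p i) * z ^ i)"
    by (simp add: poly_altdef degree_map_poly coeff_map_poly)
  also have "\<dots> = (\<Sum>i\<le>d. complex_of_real (coeff p i) * z ^ i)"
    using assms by (intro sum.mono_neutral_left) (auto simp: coeff_eq_0)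
  finally show ?thesis .
qed

lemma uniform_limit_sum:
  fixes f :: "'i \<Rightarrow> 'b \<Rightarrow> 'a \<Rightarrow> 'c::real_normed_vector"
  assumes "\<And>i. i \<in> I \<Longrightarrow> uniform_limit S (f i) (l i) F"
  shows "uniform_limit S (\<lambda>k x. \<Sum>i\<in>I. f i k x) (\<lambda>x. \<Sum>i\<in>I. l i x) F"
  using assms
  by (induction I rule: infinite_finite_induct) (auto intro!: uniform_limit_add uniform_limit_const)

text \<open>Hurwitz' theorem on \<open>S\<close>: the common degree bound makes coefficientwise
  convergence uniform on compact sets.\<close>

lemma nonvanishing_limit:
  assumes "open S" "connected S"
    and nz: "\<And>k z. z \<in> S \<Longrightarrow> poly (map_poly complex_of_real (P k)) z \<noteq> 0"
    and deg: "\<And>k. degree (P k) \<le> d" "degree Q \<le> d"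
    and lim: "coeff_tendsto P Q" and "Q \<noteq> 0" and "z \<in> S"
  shows "poly (map_poly complex_of_real Q) z \<noteq> 0"
proof (cases "poly (map_poly complex_of_real Q) constant_on S")
  \<comment> \<open>Hurwitz' theorem concerns nonconstant limits. A constant limit is nonzero
    because \<open>Q \<noteq> 0\<close> cannot vanish on the infinite set \<open>S\<close>.\<close>
  case True
  then obtain c where c: "\<And>w. w \<in> S \<Longrightarrow> poly (map_poly complex_of_real Q) w = c"
    by (auto simp: constant_on_def)
  have "infinite S"
    using \<open>z \<in> S\<close> \<open>open S\<close> finite_imp_not_open by blast
  moreover have "map_poly complex_of_real Q \<noteq> 0"
    using \<open>Q \<noteq> 0\<close> by (simp add: map_poly_eq_0_iff)
  ultimately have "\<exists>w\<in>S. poly (map_poly complex_of_real Q) w \<noteq> 0"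
    using poly_roots_finite[of "map_poly complex_of_real Q"] finite_subset by (metis (mono_tags, lifting) mem_Collect_eq subsetI)
  with c \<open>z \<in> S\<close> show ?thesis by auto
next
  case False
  show ?thesis
  proof (rule Hurwitz_no_zeros[OF assms(1,2) _ _ _ False nz \<open>z \<in> S\<close>])
    fix K assume "compact K" "K \<subseteq> S"
    have "uniform_limit K (\<lambda>k z. complex_of_real (coeff (P k) i) * z ^ i) (\<lambda>z. complex_of_real (coeff Q i) * z ^ i) sequentially" for i
    proof (rule uniform_lim_mult)
      have "(\<lambda>k. complex_of_real (coeff (P k) i)) \<longlonglongrightarrow> complex_of_real (coeff Q i)"
        using lim by (auto simp: coeff_tendsto_def intro: tendsto_intros)
      then show "uniform_limit K (\<lambda>k z. complex_of_real (coeff (P k) i)) (\<lambda>z. complex_of_real (coeff Q i)) sequentially"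
        by (auto simp: uniform_limit_iff tendsto_iff)
      show "bounded ((\<lambda>z. z ^ i) ` K)"
        by (intro compact_imp_bounded compact_continuous_image continuous_intros \<open>compact K\<close>)
      show "bounded ((\<lambda>z. complex_of_real (coeff Q i)) ` K)"
        by (rule bounded_subset[of "{complex_of_real (coeff Q i)}"]) auto
    qed (rule uniform_limit_const)
    then show "uniform_limit K (\<lambda>k. poly (map_poly complex_of_real (P k))) (poly (map_poly complex_of_real Q)) sequentially"
      unfolding poly_map_poly_of_real_altdef[OF deg(1), abs_def] poly_map_poly_of_real_altdef[OF deg(2), abs_def]
      by (intro uniform_limit_sum)
  qed (auto intro!: holomorphic_intros)
qed

text \<open>Hurwitz' theorem applies in the open upper and lower half-planes. The approximants have
  to be nonzero because \<open>real_rooted\<close> also admits the zero polynomial, which vanishes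
  there.\<close>

lemma real_rooted_limit:
  assumes rr: "\<And>k. real_rooted (P k)" and nz: "\<And>k. P k \<noteq> 0"
    and deg: "\<And>k. degree (P k) \<le> d" "degree Q \<le> d" and lim: "coeff_tendsto P Q"
  shows "real_rooted Q"
proof (cases "Q = 0")
  case False
  have roots: "poly (map_poly complex_of_real (P k)) z \<noteq> 0" if "Im z \<noteq> 0" for k z
    using rr[of k] nz[of k] that unfolding real_rooted_def by (auto simp: complex_is_Real_iff)
  have "Im z = 0" if "poly (map_poly complex_of_real Q) z = 0" for z
  proof (rule ccontr)
    assume "Im z \<noteq> 0"
    then consider "Im z > 0" | "Im z < 0" by linarith
    then show False
    proof cases
      case 1
      show False
        using nonvanishing_limit[of "{z. Im z > 0}" P d Q z] roots deg lim False 1 that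
          open_halfspace_Im_gt[of 0] convex_connected[OF convex_halfspace_Im_gt[of 0]] by auto
    next
      case 2
      show False
        using nonvanishing_limit[of "{z. Im z < 0}" P d Q z] roots deg lim False 2 that
          open_halfspace_Im_lt[of 0] convex_connected[OF convex_halfspace_Im_lt[of 0]] by auto
    qed
  qed
  then show ?thesis
    by (auto simp: real_rooted_def complex_is_Real_iff)
qed (simp add: real_rooted_def)

section \<open>Real-rooted polynomials as limits of those of degree \<open>n\<close>\<close>

lemma map_poly_of_real_prod_linear:
  "map_poly complex_of_real (smult b (\<Prod>i\<in>A. [:- r i, 1:])) =
     smult (complex_of_real b) (\<Prod>i\<in>A. [:- complex_of_real (r i), 1:])"
  by (simp add: map_poly_smult map_poly_of_real_prod map_poly_pCons)

lemma real_rooted_prod_linear: "real_rooted (smult b (\<Prod>i\<in>A. [:- r i, 1:]))"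
proof (cases "finite A")
  case True
  then show ?thesis
    unfolding real_rooted_def map_poly_of_real_prod_linear by (auto simp: poly_prod)
qed (auto simp: real_rooted_def map_poly_smult map_poly_pCons)

text \<open>The complex factorization has only real roots, and embedding the coefficients is
  injective, so it descends to the reals.\<close>

lemma real_rooted_indexed_factorization:
  assumes "real_rooted g" "g \<noteq> 0" "degree g \<le> CARD('n::finite)"
  shows "\<exists>(A :: 'n set) r. card A = degree g \<and> g = smult (lead_coeff g) (\<Prod>i\<in>A. [:- r i, 1:])"
proof -
  let ?g = "map_poly complex_of_real g"
  have deg: "degree ?g = degree g" "?g \<noteq> 0"
    using assms(2) by (auto simp: degree_map_poly map_poly_eq_0_iff)
  obtain A :: "'n set" and r where A: "card A = degree g"
    "?g = smult (complex_of_real (lead_coeff g)) (\<Prod>i\<in>A. [:- r i, 1:])"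
    using complex_poly_indexed_factorization[where 'n = 'n, of ?g] deg assms(3)
    by (auto simp: coeff_map_poly)
  have "complex_of_real (Re (r i)) = r i" if "i \<in> A" for i
  proof -
    have "poly ?g (r i) = 0"
      unfolding A(2) using that by (auto simp: poly_prod)
    then show ?thesis
      using assms(1,2) by (auto simp: real_rooted_def)
  qed
  then have "?g = map_poly complex_of_real (smult (lead_coeff g) (\<Prod>i\<in>A. [:- Re (r i), 1:]))"
    using A(2) by (simp add: map_poly_of_real_prod_linear)
  then have "g = smult (lead_coeff g) (\<Prod>i\<in>A. [:- Re (r i), 1:])"
    by (simp only: map_poly_of_real_eq_iff)
  with A(1) show ?thesis
    by (intro exI[of _ A] exI[of _ "\<lambda>i. Re (r i)"] conjI)
qed

text \<open>By Vieta's formula the coefficient of degree \<open>n - 1\<close> is \<open>- b\<close>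
  times the sum of the roots.\<close>

lemma prod_linear_in_zero_sum_polys:
  fixes r :: "'n::finite \<Rightarrow> real"
  assumes "(\<Sum>i\<in>UNIV. r i) = 0"
  shows "smult b (\<Prod>i\<in>UNIV. [:- r i, 1:]) \<in> zero_sum_polys CARD('n)"
proof -
  have "coeff (\<Prod>i\<in>UNIV. [:- r i, 1:]) (CARD('n) - 1) = 0"
    using coeff_prod_linear[of 1 r] assms esym_1[of r] by simp
  moreover have "degree (\<Prod>i\<in>UNIV. [:- r i, 1:]) \<le> CARD('n)"
    using degree_prod_sum_le[of UNIV "\<lambda>i. [:- r i, 1:]"] by simp
  ultimately show ?thesis
    by (auto simp: zero_sum_polys_def intro: order.trans[OF degree_smult_le])
qed

text \<open>
  The degree is raised to \<open>n\<close> by adding real roots that tend to infinity; one of them is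
  spent on keeping the sum of all roots equal to zero.
\<close>

lemma zero_sum_real_rooted_approximation:
  assumes "g \<in> zero_sum_real_rooted CARD('n::finite)" "g \<noteq> 0"
  shows "\<exists>b (r :: nat \<Rightarrow> 'n \<Rightarrow> real). (\<forall>k. b k \<noteq> 0) \<and>
     (\<forall>k. smult (b k) (\<Prod>i\<in>UNIV. [:- r k i, 1:]) \<in> zero_sum_polys CARD('n)) \<and>
     coeff_tendsto (\<lambda>k. smult (b k) (\<Prod>i\<in>UNIV. [:- r k i, 1:])) g"
proof -
  let ?n = "CARD('n)"
  have g: "g \<in> zero_sum_polys ?n" "real_rooted g" "degree g \<le> ?n"
    using assms(1) by (auto simp: zero_sum_real_rooted_def zero_sum_polys_def)
  obtain A :: "'n set" and \<rho> where A: "card A = degree g"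
    and fact: "g = smult (lead_coeff g) (\<Prod>i\<in>A. [:- \<rho> i, 1:])"
    using real_rooted_indexed_factorization[OF g(2) assms(2) g(3)] by blast
  have lc: "lead_coeff g \<noteq> 0"
    using assms(2) by simp
  show ?thesis
  proof (cases "A = UNIV")
    case True
    have "coeff_tendsto (\<lambda>k::nat. smult (lead_coeff g) (\<Prod>i\<in>UNIV. [:- \<rho> i, 1:])) g"
      using fact True coeff_tendsto_const[of g] by simp
    moreover have "smult (lead_coeff g) (\<Prod>i\<in>UNIV. [:- \<rho> i, 1:]) \<in> zero_sum_polys ?n"
      using fact True g(1) by simp
    ultimately show ?thesis
      using lc by (intro exI[of _ "\<lambda>_. lead_coeff g"] exI[of _ "\<lambda>_. \<rho>"]) simp
  next
    case False
    then obtain i0 where i0: "i0 \<notin> A" by blast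
    \<comment> \<open>The index \<open>i0\<close> carries the balancing root, and the other
      \<open>N\<close> free indices share the root \<open>K k\<close>.\<close>
    define N where "N = real (card (- A - {i0}))"
    define R where "R = (\<Sum>i\<in>A. \<rho> i)"
    \<comment> \<open>The summand \<open>\<bar>R\<bar>\<close> makes even the balancing root at
      least \<open>k + 1\<close> in absolute value.\<close>
    define K where "K k = real k + 1 + \<bar>R\<bar>" for k :: nat
    define r where "r k i = (if i \<in> A then \<rho> i else if i = i0 then - (N * K k + R) else K k)" for k i
    \<comment> \<open>Degree \<open>n - 1\<close> is impossible in the space, so at least two
      indices are free. A single free index would carry the fixed root \<open>- R\<close>, which
      cannot tend to infinity.\<close>
    have "coeff g (?n - 1) = 0"
      using g(1) by (simp add: zero_sum_polys_def)
    then have "degree g \<noteq> ?n - 1"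
      using lc by metis
    moreover have "card (- A - {i0}) = ?n - degree g - 1"
      using i0 A by (simp add: card_Compl)
    ultimately have N: "N \<ge> 1"
      using g(3) A False card_subset_eq[of UNIV A] unfolding N_def by fastforce
    have K: "K k > 0" "N * K k + R \<ge> real k + 1" for k
    proof -
      show "K k > 0" by (simp add: K_def)
      then have "N * K k \<ge> 1 * K k"
        using N by (intro mult_right_mono) auto
      then show "N * K k + R \<ge> real k + 1" by (simp add: K_def)
    qed
    have sum: "(\<Sum>i\<in>UNIV. r k i) = 0" for k
    proof -
      have "UNIV = A \<union> insert i0 (- A - {i0})" by auto
      then have "(\<Sum>i\<in>UNIV. r k i) = (\<Sum>i\<in>A. r k i) + (\<Sum>i\<in>insert i0 (- A - {i0}). r k i)"
        using i0 by (metis (no_types, lifting) Compl_iff DiffD1 disjoint_iff finite insertE sum.union_disjoint)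
      also have "(\<Sum>i\<in>A. r k i) = R"
        by (simp add: r_def R_def)
      also have "(\<Sum>i\<in>insert i0 (- A - {i0}). r k i) = r k i0 + (\<Sum>i\<in>- A - {i0}. r k i)"
        by (rule sum.insert) auto
      also have "(\<Sum>i\<in>- A - {i0}. r k i) = (\<Sum>i\<in>- A - {i0}. K k)"
        by (rule sum.cong) (auto simp: r_def)
      finally show ?thesis
        using i0 by (simp add: N_def r_def)
    qed
    have r: "r k i \<noteq> 0" if "i \<in> - A" for k i
      using that K[of k] by (auto simp: r_def)
    \<comment> \<open>This scaling turns each added factor \<open>t - r\<close> into
      \<open>1 - t / r\<close>, which tends to 1 as \<open>r\<close> grows in absolute
      value.\<close>
    define b where "b k = lead_coeff g * (\<Prod>i\<in>- A. - 1 / r k i)" for k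
    have b: "b k \<noteq> 0" for k
      using lc r by (auto simp: b_def)
    have eq: "smult (b k) (\<Prod>i\<in>UNIV. [:- r k i, 1:]) = g * (\<Prod>i\<in>- A. [:1, - 1 / r k i:])" for k
    proof -
      have "(\<Prod>i\<in>UNIV. [:- r k i, 1:]) = (\<Prod>i\<in>A. [:- r k i, 1:]) * (\<Prod>i\<in>- A. [:- r k i, 1:])"
        by (subst prod.union_disjoint[symmetric]) (auto simp: Compl_partition)
      also have "(\<Prod>i\<in>A. [:- r k i, 1:]) = (\<Prod>i\<in>A. [:- \<rho> i, 1:])"
        by (intro prod.cong) (auto simp: r_def)
      finally have "smult (b k) (\<Prod>i\<in>UNIV. [:- r k i, 1:]) =
          smult (lead_coeff g) (\<Prod>i\<in>A. [:- \<rho> i, 1:]) *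
          smult (\<Prod>i\<in>- A. - 1 / r k i) (\<Prod>i\<in>- A. [:- r k i, 1:])"
        by (simp only: b_def mult_smult_left mult_smult_right smult_smult mult.commute)
      also have "smult (lead_coeff g) (\<Prod>i\<in>A. [:- \<rho> i, 1:]) = g"
        by (rule fact[symmetric])
      also have "smult (\<Prod>i\<in>- A. - 1 / r k i) (\<Prod>i\<in>- A. [:- r k i, 1:]) =
          (\<Prod>i\<in>- A. smult (- 1 / r k i) [:- r k i, 1:])"
        by (rule prod_smult[symmetric])
      also have "\<dots> = (\<Prod>i\<in>- A. [:1, - 1 / r k i:])"
        by (rule prod.cong) (use r in auto)
      finally show ?thesis .
    qed
    have inv0: "(\<lambda>k. - 1 / r k i) \<longlonglongrightarrow> 0" if "i \<in> - A" for i
    proof (rule Lim_null_comparison)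
      show "\<forall>\<^sub>F k in sequentially. norm (- 1 / r k i) \<le> inverse (real (Suc k))"
      proof (rule always_eventually, rule allI)
        fix k
        have "\<bar>r k i\<bar> \<ge> real (Suc k)"
          using that K[of k] by (auto simp: r_def K_def)
        then show "norm (- 1 / r k i) \<le> inverse (real (Suc k))"
          by (simp add: divide_simps)
      qed
      show "(\<lambda>k. inverse (real (Suc k))) \<longlonglongrightarrow> 0"
        by (rule LIMSEQ_inverse_real_of_nat)
    qed
    have "coeff_tendsto (\<lambda>k. [:1, - 1 / r k i:]) 1" if "i \<in> - A" for i
      unfolding coeff_tendsto_def
    proof
      fix j
      show "(\<lambda>k. coeff [:1, - 1 / r k i:] j) \<longlonglongrightarrow> coeff 1 j"
      proof (cases j)
        case (Suc l)
        with inv0[OF that] show ?thesis by (cases l) simp_all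
      qed simp
    qed
    then have "coeff_tendsto (\<lambda>k. \<Prod>i\<in>- A. [:1, - 1 / r k i:]) (\<Prod>i\<in>- A. 1)"
      by (rule coeff_tendsto_prod)
    then have "coeff_tendsto (\<lambda>k. g * (\<Prod>i\<in>- A. [:1, - 1 / r k i:])) (g * 1)"
      by (intro coeff_tendsto_mult coeff_tendsto_const) simp
    then have "coeff_tendsto (\<lambda>k. smult (b k) (\<Prod>i\<in>UNIV. [:- r k i, 1:])) g"
      unfolding eq by simp
    with b prod_linear_in_zero_sum_polys[OF sum] show ?thesis
      by blast
  qed
qed

section \<open>Hyperbolicity and preservation of real-rootedness\<close>

lemma esym_all_ones: "esym k (\<lambda>i::'n::finite. 1) = of_nat (CARD('n) choose k)"
  using n_subsets[of "UNIV :: 'n set" k] by (simp add: esym_def)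

text \<open>The weight of index 0 multiplies the coefficient of degree \<open>n\<close>, so a
  nonzero value at the all-ones vector keeps images of polynomials of degree \<open>n\<close> from
  vanishing.\<close>

lemma eval_hook_ones: "eval_real (hook d a :: 'n::finite mpol) 1 = (-1) ^ d * hook_weight CARD('n) d a 0"
  by (simp add: real_hom.mp_eval_hook hook_weight_def esym_all_ones)

lemma poly_line_restriction:
  "poly (map_poly complex_of_real (line_restriction p x 1)) z =
     mp_eval complex_of_real (\<lambda>i. complex_of_real (x $ i) + z) p"
  by (simp add: line_restriction_def poly_mp_eval map_poly_pCons)

text \<open>Up to the factor \<open>b\<close> and the reflection of \<open>t\<close>, the image is
  the hook polynomial on the line through the root vector in the all-ones direction.\<close>

lemma poly_diag_op_prod_linear:
  fixes r :: "real ^ 'n::finite"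
  assumes "b \<noteq> 0" "smult b (\<Prod>i\<in>UNIV. [:- (r $ i), 1:]) \<in> zero_sum_polys CARD('n)"
  shows "poly (map_poly complex_of_real
      (diag_op CARD('n) d (hook_weight CARD('n) d a) (smult b (\<Prod>i\<in>UNIV. [:- (r $ i), 1:])))) t =
    complex_of_real b * poly (map_poly complex_of_real (line_restriction (hook d a) r 1)) (- t)"
proof -
  have "map_poly complex_of_real (smult b (\<Prod>i\<in>UNIV. [:- (r $ i), 1:])) =
      smult (complex_of_real b) (\<Prod>i\<in>UNIV. [:- ((\<chi> i. complex_of_real (r $ i)) $ i), 1:])"
    by (simp add: map_poly_of_real_prod_linear)
  from diag_op_root_formula[OF assms(2,1) this, of d a t] show ?thesis
    by (simp add: poly_line_restriction vector_scalar_mult_def)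
qed

text \<open>In degree \<open>n\<close> the roots of the image are the negated roots of a line
  restriction. A general nonzero \<open>g\<close> is a limit of such polynomials.\<close>

lemma hyperbolic_imp_preserver:
  assumes hyp: "hyperbolic (hook d a :: 'n::finite mpol) 1"
  shows "zero_sum_preserver CARD('n) d (diag_op CARD('n) d (hook_weight CARD('n) d a))"
proof -
  let ?T = "diag_op CARD('n) d (hook_weight CARD('n) d a)"
  have "real_rooted (?T g)" if g: "g \<in> zero_sum_real_rooted CARD('n)" for g
  proof (cases "g = 0")
    case True
    have "?T 0 = 0"
      by (simp add: poly_eq_iff coeff_diag_op zero_sum_polys_0)
    with True show ?thesis by (simp add: real_rooted_def)
  next
    case False
    obtain b and r :: "nat \<Rightarrow> 'n \<Rightarrow> real" where b: "\<And>k. b k \<noteq> 0"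
      and Z: "\<And>k. smult (b k) (\<Prod>i\<in>UNIV. [:- r k i, 1:]) \<in> zero_sum_polys CARD('n)"
      and lim: "coeff_tendsto (\<lambda>k. smult (b k) (\<Prod>i\<in>UNIV. [:- r k i, 1:])) g"
      using zero_sum_real_rooted_approximation[OF g False] by blast
    let ?G = "\<lambda>k. smult (b k) (\<Prod>i\<in>UNIV. [:- r k i, 1:])"
    have gZ: "g \<in> zero_sum_polys CARD('n)"
      using g by (simp add: zero_sum_real_rooted_def)
    \<comment> \<open>The coefficient of degree \<open>d\<close> is the weight of index 0 times
      \<open>b k\<close>; the weight is nonzero by hyperbolicity.\<close>
    have nz: "?T (?G k) \<noteq> 0" for k
    proof -
      have "coeff (?T (?G k)) d = hook_weight CARD('n) d a 0 * coeff (?G k) (CARD('n) - 0)"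
        using coeff_diag_op[OF Z[of k], of d "hook_weight CARD('n) d a" d] by (simp add: diag_indices_def)
      also have "coeff (?G k) (CARD('n) - 0) = b k"
        using coeff_prod_linear[of 0 "r k"] by (simp add: esym_def)
      finally have "coeff (?T (?G k)) d \<noteq> 0"
        using hyp b[of k] eval_hook_ones[where 'n = 'n, of d a] by (auto simp: hyperbolic_def)
      then show ?thesis by auto
    qed
    have formula: "poly (map_poly complex_of_real (?T (?G k))) t =
        complex_of_real (b k) * poly (map_poly complex_of_real (line_restriction (hook d a) (vec_lambda (r k)) 1)) (- t)" for k t
      using poly_diag_op_prod_linear[of "b k" "vec_lambda (r k)"] b Z by simp
    have "real_rooted (?T (?G k))" for k
      unfolding real_rooted_def
    proof (intro disjI2 allI impI)
      fix z assume z: "poly (map_poly complex_of_real (?T (?G k))) z = 0"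
      let ?l = "line_restriction (hook d a) (vec_lambda (r k)) 1"
      \<comment> \<open>A real-rooted polynomial may be zero, and then its roots need not be
        real.\<close>
      have "?l \<noteq> 0"
      proof
        assume "?l = 0"
        then have "poly (map_poly complex_of_real (?T (?G k))) = poly (map_poly complex_of_real 0)"
          using formula by auto
        with nz show False
          by (simp only: poly_eq_poly_eq_iff map_poly_of_real_eq_iff)
      qed
      moreover have "real_rooted ?l"
        using hyp by (simp add: hyperbolic_def)
      moreover have "poly (map_poly complex_of_real ?l) (- z) = 0"
        using z b formula by simp
      ultimately have "- z \<in> \<real>"
        by (auto simp: real_rooted_def)
      then show "z \<in> \<real>" by simp
    qed
    moreover have "coeff_tendsto (\<lambda>k. ?T (?G k)) (?T g)"
      by (rule coeff_continuousD[OF coeff_continuous_diag_op Z gZ lim])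
    moreover have "degree (?T f) \<le> d" if "f \<in> zero_sum_polys CARD('n)" for f
      using diag_op_in_zero_sum_polys[OF that, of d] by (simp add: zero_sum_polys_def)
    ultimately show ?thesis
      using real_rooted_limit[of "\<lambda>k. ?T (?G k)" d "?T g"] nz Z gZ by blast
  qed
  moreover have "g \<in> zero_sum_polys CARD('n)" if "g \<in> zero_sum_real_rooted CARD('n)" for g
    using that by (simp add: zero_sum_real_rooted_def)
  ultimately have "?T ` zero_sum_real_rooted CARD('n) \<subseteq> zero_sum_real_rooted d"
    unfolding zero_sum_real_rooted_def[of d] using diag_op_in_zero_sum_polys by blast
  then show ?thesis
    by (simp add: zero_sum_preserver_def diag_op_linear_maps)
qed

text \<open>Every line in the all-ones direction contains a point with coordinate sum zero, where
  preservation applies; a real translation of the parameter keeps roots real.\<close>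

lemma preserver_imp_hyperbolic:
  assumes "eval_real (hook d a :: 'n::finite mpol) 1 \<noteq> 0"
    and pres: "zero_sum_preserver CARD('n) d (diag_op CARD('n) d (hook_weight CARD('n) d a))"
  shows "hyperbolic (hook d a :: 'n mpol) 1"
  unfolding hyperbolic_def
proof (intro conjI allI)
  show "\<exists>k. homogeneous k (hook d a :: 'n mpol)"
    using homogeneous_hook by blast
  show "eval_real (hook d a :: 'n mpol) 1 \<noteq> 0" by fact
  fix x :: "real ^ 'n"
  let ?T = "diag_op CARD('n) d (hook_weight CARD('n) d a)"
  let ?l = "line_restriction (hook d a) x 1"
  \<comment> \<open>Subtracting the mean of the coordinates makes their sum zero.\<close>
  define s where "s = (\<Sum>i\<in>UNIV. x $ i) / CARD('n)"
  define y :: "real ^ 'n" where "y = (\<chi> i. x $ i - s)"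
  let ?G = "smult 1 (\<Prod>i\<in>UNIV. [:- (y $ i), 1:])"
  have Z: "?G \<in> zero_sum_polys CARD('n)"
    by (rule prod_linear_in_zero_sum_polys) (simp add: y_def s_def sum_subtractf)
  then have "?G \<in> zero_sum_real_rooted CARD('n)"
    unfolding zero_sum_real_rooted_def by (intro CollectI conjI real_rooted_prod_linear)
  with pres have rr: "real_rooted (?T ?G)"
    unfolding zero_sum_preserver_def zero_sum_real_rooted_def by blast
  \<comment> \<open>The reflection in the root formula and the translation by \<open>s\<close>
    combine into this substitution.\<close>
  have formula: "poly (map_poly complex_of_real (?T ?G)) (- (z + complex_of_real s)) =
      poly (map_poly complex_of_real ?l) z" for z
    using poly_diag_op_prod_linear[OF _ Z, of d a "- (z + complex_of_real s)"]
    by (simp add: poly_line_restriction y_def)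
  show "real_rooted ?l"
  proof (cases "?T ?G = 0")
    case True
    then have "poly (map_poly complex_of_real ?l) = poly (map_poly complex_of_real 0)"
      using formula by auto
    then have "?l = 0"
      by (metis poly_eq_poly_eq_iff map_poly_of_real_eq_iff)
    then show ?thesis by (simp add: real_rooted_def)
  next
    case False
    show ?thesis
      unfolding real_rooted_def
    proof (intro disjI2 allI impI)
      fix z assume "poly (map_poly complex_of_real ?l) z = 0"
      with rr False formula[of z] have "- (z + complex_of_real s) \<in> \<real>"
        by (auto simp: real_rooted_def)
      then show "z \<in> \<real>"
        by (simp add: complex_is_Real_iff)
    qed
  qed
qed

theorem theorem1p6:
  fixes d :: nat
  assumes "d \<ge> 1"
  shows "(\<forall>p \<in> (hook_shaped d :: 'n::finite mpol set).
            is_associated_operator d p (associated_operator d p) \<and>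
            associated_operator d p \<in> diagonal_maps CARD('n) d \<and>
            (symmetric_hyperbolic p \<longleftrightarrow>
               eval_real p 1 \<noteq> 0 \<and> zero_sum_preserver CARD('n) d (associated_operator d p))) \<and>
         (\<forall>p \<in> (hook_shaped d :: 'n mpol set). \<forall>q \<in> hook_shaped d. \<forall>g \<in> zero_sum_polys CARD('n).
            associated_operator d (p + q) g = associated_operator d p g + associated_operator d q g) \<and>
         (\<forall>c. \<forall>p \<in> (hook_shaped d :: 'n mpol set). \<forall>g \<in> zero_sum_polys CARD('n).
            associated_operator d (Const c * p) g = smult c (associated_operator d p g)) \<and>
         bij_betw (associated_operator d) (hook_shaped d :: 'n mpol set) (diagonal_maps CARD('n) d)"
proof -
  let ?n = "CARD('n)"
  \<comment> \<open>The weights are linear in the coefficients, which makes the associated operator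
    linear in \<open>p\<close>.\<close>
  have weight_add: "hook_weight ?n d (\<lambda>i. a i + b i) j = hook_weight ?n d a j + hook_weight ?n d b j" for a b j
    unfolding hook_weight_def distrib_left[symmetric] sum.distrib[symmetric]
    by (intro arg_cong2[where f = "(*)"] sum.cong refl) (auto simp: algebra_simps)
  have weight_mult: "hook_weight ?n d (\<lambda>i. c * a i) j = c * hook_weight ?n d a j" for a c j
    by (auto simp: hook_weight_def sum_distrib_left intro!: sum.cong)
  have "is_associated_operator d p (associated_operator d p) \<and>
      associated_operator d p \<in> diagonal_maps ?n d \<and>
      (symmetric_hyperbolic p \<longleftrightarrow>
        eval_real p 1 \<noteq> 0 \<and> zero_sum_preserver ?n d (associated_operator d p))"
    if p_hook: "p \<in> hook_shaped d" for p :: "'n mpol"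
  proof -
    obtain a where p: "p = hook d a"
      using p_hook unfolding hook_shaped_eq by blast
    have "symmetric_hyperbolic p \<longleftrightarrow>
        eval_real p 1 \<noteq> 0 \<and> zero_sum_preserver ?n d (associated_operator d p)"
      unfolding p associated_operator_hook symmetric_hyperbolic_def
    proof (intro iffI conjI; (elim conjE)?)
      assume hyp: "hyperbolic (hook d a :: 'n mpol) 1"
      then show "eval_real (hook d a :: 'n mpol) 1 \<noteq> 0"
        by (simp add: hyperbolic_def)
      show "zero_sum_preserver ?n d (diag_op ?n d (hook_weight ?n d a))"
        using hyp by (rule hyperbolic_imp_preserver)
    qed (rule symmetric_hook preserver_imp_hyperbolic; assumption)+
    then show ?thesis
      unfolding p associated_operator_hook
      using is_associated_operator_hook diag_op_diagonal_maps[OF assms] by blast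
  qed
  moreover have "associated_operator d (p + q) g = associated_operator d p g + associated_operator d q g"
    if pq: "p \<in> hook_shaped d" "q \<in> hook_shaped d" and g: "g \<in> zero_sum_polys ?n" for p q :: "'n mpol" and g
  proof -
    obtain a b where "p = hook d a" "q = hook d b"
      using pq unfolding hook_shaped_eq by blast
    then show ?thesis
      using g
      by (auto simp: associated_operator_hook poly_eq_iff coeff_diag_op weight_add algebra_simps simp flip: hook_add)
  qed
  moreover have "associated_operator d (Const c * p) g = smult c (associated_operator d p g)"
    if p_hook: "p \<in> hook_shaped d" and g: "g \<in> zero_sum_polys ?n" for p :: "'n mpol" and c g
  proof -
    obtain a where "p = hook d a"
      using p_hook unfolding hook_shaped_eq by blast
    then show ?thesis
      using g
      by (auto simp: associated_operator_hook poly_eq_iff coeff_diag_op weight_mult simp flip: hook_mult)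
  qed
  moreover have "bij_betw (associated_operator d) (hook_shaped d :: 'n mpol set) (diagonal_maps ?n d)"
    unfolding bij_betw_def
  proof
    show "inj_on (associated_operator d) (hook_shaped d :: 'n mpol set)"
      \<comment> \<open>Equal operators have equal weights, and the weights determine the
        polynomial.\<close>
      by (auto simp: inj_on_def hook_shaped_eq associated_operator_hook diag_op_eq_iff intro: hook_cong_weight)
    show "associated_operator d ` (hook_shaped d :: 'n mpol set) = diagonal_maps ?n d"
    proof
      show "associated_operator d ` (hook_shaped d :: 'n mpol set) \<subseteq> diagonal_maps ?n d"
        by (auto simp: hook_shaped_eq associated_operator_hook diag_op_diagonal_maps[OF assms])
      show "diagonal_maps ?n d \<subseteq> associated_operator d ` (hook_shaped d :: 'n mpol set)"
      proof
        fix T assume "T \<in> diagonal_maps ?n d"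
        then obtain \<gamma> where T: "T = diag_op ?n d \<gamma>"
          using diagonal_maps_imp_diag_op by blast
        obtain a where "\<forall>j\<in>diag_indices ?n d. hook_weight ?n d a j = \<gamma> j"
          using hook_weight_surj[of ?n d \<gamma>] assms by auto
        then have "T = associated_operator d (hook d a :: 'n mpol)"
          by (simp add: T associated_operator_hook diag_op_eq_iff)
        then show "T \<in> associated_operator d ` (hook_shaped d :: 'n mpol set)"
          by (auto simp: hook_shaped_eq)
      qed
    qed
  qed
  ultimately show ?thesis
    by blast
qed

end
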